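(* Let $T=\{1234,3412,4123\}$ and let $F_T(x)=\sum_{n\ge0}|S_n(T)|x^n$. Then $$F_T(x)=\frac{1-14x+87x^2-315x^3+736x^4-1161x^5+1253x^6-918x^7+446x^8-134x^9+18x^{10}}{(1-x)^6(1-2x)^3(1-3x+x^2)}.$$
   Context: $S_n$ is the set of permutations of $[n]$ ($S_0$ contains the empty permutation). A permutation avoids a pattern $\tau$ if it has no subsequence order-isomorphic to $\tau$; $S_n(T)$ is the set of permutations in $S_n$ avoiding every pattern in $T$. *)

theory Defs
  imports
    "HOL-Library.Sublist"
    "HOL-Combinatorics.Multiset_Permutations"
    "HOL-Computational_Algebra.Formal_Power_Series"
begin

(* Permutations of [n] and patterns are written in one-line notation, as lists of naturals;
   S_n is permutations_of_set {1..n}, and S_0 = {[]}. *)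

definition order_isomorphic :: "nat list \<Rightarrow> nat list \<Rightarrow> bool" where
  "order_isomorphic xs ys \<longleftrightarrow>
     length xs = length ys \<and>
     (\<forall>i < length xs. \<forall>j < length xs. xs ! i < xs ! j \<longleftrightarrow> ys ! i < ys ! j)"

(* Sublist.subseq is the scattered (not necessarily contiguous) subsequence relation. *)
definition avoids :: "nat list \<Rightarrow> nat list \<Rightarrow> bool" where
  "avoids \<sigma> \<tau> \<longleftrightarrow> \<not> (\<exists>xs. subseq xs \<sigma> \<and> order_isomorphic xs \<tau>)"

definition avoiders :: "nat \<Rightarrow> nat list set \<Rightarrow> nat list set" where
  "avoiders n T = {\<sigma> \<in> permutations_of_set {1..n}. \<forall>\<tau> \<in> T. avoids \<sigma> \<tau>}"

(* Coefficients are taken in the field of rationals so that the quotient of two formal power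
   series with invertible denominator is the usual one. *)
definition avoiders_gf :: "nat list set \<Rightarrow> rat fps" where
  "avoiders_gf T = Abs_fps (\<lambda>n. of_nat (card (avoiders n T)))"

end

(* Permutations avoiding 1234, 3412 and 4123 are generated by prepending letters. Whether a letter
   can be prepended depends only on which gaps between values are still active and, for each gap, on
   the smallest top of an ascent above it. These data evolve deterministically, and starting from the
   empty permutation they fall into seven parametrised families whose succession rules depend on the
   parameters alone. The resulting linear system of generating functions has an explicit solution in
   powers of 1/(1-x), 1/(1-2x) and 1/(1-3x+x^2), and the family of the empty permutation yields the
   claimed rational function. *)

theory Submission
  imports Defs
begin

section \<open>The generating tree\<close>

text \<open>All three patterns end in an ascent. A pattern whose second letter has just been
  prepended is therefore completed by an ascent of the older letters, and the lowest top above each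
  gap is all that must be remembered. In the order F, E', E, G, C, B, D each family has children
  only in itself and in earlier families, so the series can be found one family at a time. The
  obstacle is that B and D raise their own parameters, so their equations cannot be solved by
  recursion on the parameters. An explicit ansatz is verified instead, and induction on the depth
  plays the part of uniqueness: in \<open>f = 1 + fps_X * g\<close>, coefficient
  \<open>Suc m\<close> of \<open>f\<close> is coefficient \<open>m\<close> of
  \<open>g\<close>.\<close>

definition lift :: "nat \<Rightarrow> nat \<Rightarrow> nat" where
  "lift g y = (if y \<le> g then y else Suc y)"

text \<open>A permutation \<open>\<sigma>\<close> of \<open>{1..n}\<close> is grown by prepending the value \<open>Suc g\<close>, where the gap \<open>g\<close> lies
  between the values \<open>g\<close> and \<open>Suc g\<close>. Its state consists of the set \<open>A\<close> of gaps that create no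
  forbidden pattern and of the function \<open>u\<close>, where \<open>u h\<close> is the least \<open>d\<close> such that \<open>h < c < d\<close> for
  some \<open>c\<close> to the left of \<open>d\<close> in \<open>\<sigma>\<close>, and \<open>Suc n\<close> if there is no such pair. The pairs
  \<open>(Suc g, d)\<close> created by the new first letter decide which gaps remain active.\<close>

definition child_gaps :: "nat \<Rightarrow> nat set \<Rightarrow> (nat \<Rightarrow> nat) \<Rightarrow> nat \<Rightarrow> nat set" where
  "child_gaps n A u g =
     {h \<in> A. h \<le> g \<and> n < u g \<and> h < u 0} \<union> Suc ` {h \<in> A. g \<le> h \<and> h < u g}"

text \<open>For \<open>h \<le> g\<close> the new first letter \<open>Suc g\<close> is itself the
  bottom of an ascent, with lowest top \<open>g + 2\<close>. If \<open>g = n\<close>, no larger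
  letter exists, and \<open>g + 2\<close> is exactly the default value for length
  \<open>Suc n\<close>.\<close>

definition child_top :: "(nat \<Rightarrow> nat) \<Rightarrow> nat \<Rightarrow> nat \<Rightarrow> nat" where
  "child_top u g h =
     (if h \<le> g then min (lift g (u h)) (g + 2) else lift g (u (h - 1)))"

primrec tree_count :: "nat \<Rightarrow> nat \<Rightarrow> nat set \<Rightarrow> (nat \<Rightarrow> nat) \<Rightarrow> nat" where
  "tree_count 0 n A u = 1"
| "tree_count (Suc m) n A u =
     (\<Sum>g\<in>A. tree_count m (Suc n) (child_gaps n A u g) (child_top u g))"

text \<open>Counted from the top, the elements of \<open>A\<close> have ranks 1, 2, and so on. This
  turns a sum over the gaps of a block into a sum over the parameter of the child.\<close>

lemma sum_card_above:
  fixes A :: "'a::linorder set"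
  assumes "finite A"
  shows "(\<Sum>g\<in>A. f (card {h \<in> A. g \<le> h})) = (\<Sum>k=1..card A. f k)"
  using assms
proof (induction A rule: finite_linorder_min_induct)
  case empty
  then show ?case by simp
next
  case (insert b A)
  have "{h \<in> insert b A. b \<le> h} = insert b A"
    using insert by force
  moreover have "{h \<in> insert b A. g \<le> h} = {h \<in> A. g \<le> h}" if "g \<in> A" for g
    using insert that by force
  ultimately show ?case
    using insert by (auto simp: add.commute)
qed

text \<open>The states that occur fall into seven families. Only the relative position of the active gaps
  and of the values of \<open>u\<close> matters, so each family records the sizes of the blocks into which
  \<open>A\<close> splits. With brackets for the parameters, the succession rules are
  \<open>F(k) \<rightarrow> F(1..k)\<close>, \<open>E'(k) \<rightarrow> E'(k), F(1..k)\<close>, \<open>E(k) \<rightarrow> E(k), E(1), F(2..k)\<close>,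
  \<open>G(i,r) \<rightarrow> E'(1..i), E'(0), G(i,1..r)\<close>, \<open>C(i,r) \<rightarrow> E'(1..i), E(1), C(i,r), G(i,1..r)\<close>,
  \<open>B(i,j) \<rightarrow> E(1..i), B(i+1,j), B(i,1), C(i,1..j-1)\<close> and
  \<open>D(n) \<rightarrow> D(n+1), B(s+1,n-s)\<close> for \<open>s < n\<close>.\<close>

definition state_F :: "nat \<Rightarrow> nat set \<Rightarrow> (nat \<Rightarrow> nat) \<Rightarrow> bool" where
  "state_F k A u \<longleftrightarrow>
     finite A \<and> card A = k \<and> (\<forall>h\<in>A. u 0 \<le> h) \<and> (\<forall>h\<in>A. \<forall>h'\<in>A. h' < u h)"

definition state_E' :: "nat \<Rightarrow> nat \<Rightarrow> nat set \<Rightarrow> (nat \<Rightarrow> nat) \<Rightarrow> bool" where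
  "state_E' k n A u \<longleftrightarrow>
     (\<exists>a P. A = insert a P \<and> finite P \<and> card P = k \<and> a < u 0 \<and> (\<forall>p\<in>P. u 0 \<le> p) \<and>
        (\<forall>h\<in>A. \<forall>h'\<in>A. h' < u h) \<and> (\<forall>h\<in>A. u h \<le> n))"

definition state_E :: "nat \<Rightarrow> nat \<Rightarrow> nat set \<Rightarrow> (nat \<Rightarrow> nat) \<Rightarrow> bool" where
  "state_E k n A u \<longleftrightarrow>
     (\<exists>a P c. A = insert a (insert c P) \<and> finite P \<and> Suc (card P) = k \<and>
        a < u 0 \<and> u 0 \<le> c \<and> (\<forall>p\<in>P. u 0 \<le> p \<and> p < c) \<and>
        (\<forall>h\<in>insert a P. c < u h \<and> u h \<le> n) \<and> u c = Suc n)"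

text \<open>A nonempty \<open>R\<close> forces \<open>u b \<le> n\<close>, so letters at
  \<open>L\<close> or \<open>b\<close> lose every gap that stays below them.\<close>

definition state_G :: "nat \<Rightarrow> nat \<Rightarrow> nat \<Rightarrow> nat set \<Rightarrow> (nat \<Rightarrow> nat) \<Rightarrow> bool" where
  "state_G i r n A u \<longleftrightarrow>
     (\<exists>L b R. A = L \<union> insert b R \<and> finite L \<and> finite R \<and> card L = i \<and> card R = r \<and> R \<noteq> {} \<and>
        b < u 0 \<and> u 0 \<le> u b \<and> (\<forall>l\<in>L. l < b \<and> u l = u 0) \<and>
        (\<forall>h\<in>R. u b \<le> h \<and> h \<le> n \<and> u h = Suc n))"

definition state_C :: "nat \<Rightarrow> nat \<Rightarrow> nat \<Rightarrow> nat set \<Rightarrow> (nat \<Rightarrow> nat) \<Rightarrow> bool" where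
  "state_C i r n A u \<longleftrightarrow>
     (\<exists>L b c R. A = L \<union> insert b (insert c R) \<and> finite L \<and> finite R \<and>
        card L = i \<and> card R = r \<and> R \<noteq> {} \<and>
        b < u 0 \<and> u 0 \<le> c \<and> u b = Suc c \<and> (\<forall>l\<in>L. l < b \<and> u l = u 0) \<and>
        u c = Suc n \<and> (\<forall>h\<in>R. c < h \<and> h \<le> n \<and> u h = Suc n))"

text \<open>In contrast to G and C, no ascent lies above \<open>b\<close>: a letter at
  \<open>b\<close> deletes nothing and splits \<open>b\<close> in two, which is why the first
  parameter can grow.\<close>

definition state_B :: "nat \<Rightarrow> nat \<Rightarrow> nat \<Rightarrow> nat set \<Rightarrow> (nat \<Rightarrow> nat) \<Rightarrow> bool" where
  "state_B i j n A u \<longleftrightarrow>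
     (\<exists>L b R. A = L \<union> insert b (insert n R) \<and> finite L \<and> finite R \<and>
        card L = i \<and> Suc (card R) = j \<and>
        b < u 0 \<and> u 0 \<le> n \<and> (\<forall>l\<in>L. l < b \<and> u l = u 0) \<and>
        u b = Suc n \<and> u n = Suc n \<and> (\<forall>h\<in>R. u 0 \<le> h \<and> h < n \<and> u h = Suc n))"

text \<open>This is the state of the decreasing permutation, which has no ascent.\<close>

definition state_D :: "nat \<Rightarrow> nat set \<Rightarrow> (nat \<Rightarrow> nat) \<Rightarrow> bool" where
  "state_D n A u \<longleftrightarrow> A = {0..n} \<and> (\<forall>h\<le>n. u h = Suc n)"

section \<open>Succession rules of the seven families\<close>

lemma lift_gt: "g < y \<Longrightarrow> lift g y = Suc y"
  and lift_le: "y \<le> g \<Longrightarrow> lift g y = y"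
  by (auto simp: lift_def)

text \<open>No active gap is below \<open>u 0\<close>, so nothing survives below the new letter;
  every gap from \<open>g\<close> upwards is below \<open>u g\<close> and survives.\<close>

lemma children_F:
  assumes "state_F k A u" and g: "g \<in> A"
  shows "state_F (card {h \<in> A. g \<le> h}) (child_gaps n A u g) (child_top u g)"
proof -
  have A: "finite A" "\<And>h. h \<in> A \<Longrightarrow> u 0 \<le> h" "\<And>h h'. h \<in> A \<Longrightarrow> h' \<in> A \<Longrightarrow> h' < u h"
    using assms by (auto simp: state_F_def)
  have gaps: "child_gaps n A u g = Suc ` {h \<in> A. g \<le> h}"
    using A g by (force simp: child_gaps_def)
  have top: "child_top u g (Suc h) = Suc (u h)" if "h \<in> A" "g \<le> h" for h
    using A(3)[OF that(1) g] that by (simp add: child_top_def lift_gt)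
  have top0: "child_top u g 0 = u 0"
    using A(2)[OF g] by (simp add: child_top_def lift_le)
  show ?thesis
    unfolding state_F_def gaps using A g by (auto simp: card_image top top0 intro: le_SucI)
qed

text \<open>Since every \<open>u h\<close> is at most \<open>n\<close>, the pattern 1234 removes all
  gaps below the new letter. A letter at \<open>a\<close> thus shifts every gap once, and a letter
  in \<open>P\<close> loses \<open>a\<close>, leaving an F state.\<close>

lemma children_E':
  assumes "state_E' k n A u"
  obtains a P where "A = insert a P" "a \<notin> P" "finite P" "card P = k"
    "state_E' k (Suc n) (child_gaps n A u a) (child_top u a)"
    "\<And>p. p \<in> P \<Longrightarrow> state_F (card {h \<in> P. p \<le> h}) (child_gaps n A u p) (child_top u p)"
proof -
  obtain a P where A: "A = insert a P" "finite P" "card P = k" "a < u 0"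
    "\<And>p. p \<in> P \<Longrightarrow> u 0 \<le> p"
    "\<And>h h'. h \<in> A \<Longrightarrow> h' \<in> A \<Longrightarrow> h' < u h" "\<And>h. h \<in> A \<Longrightarrow> u h \<le> n"
    using assms by (auto simp: state_E'_def)
  have ap: "a < p" if "p \<in> P" for p
    using A(4) A(5)[OF that] by linarith
  have top: "child_top u g (Suc h) = Suc (u h)" if "h \<in> A" "g \<in> A" "g \<le> h" for g h
    using A(6)[OF that(1,2)] that by (simp add: child_top_def lift_gt)
  have first: "state_E' k (Suc n) (child_gaps n A u a) (child_top u a)"
  proof -
    have gaps: "child_gaps n A u a = insert (Suc a) (Suc ` P)"
      using A ap by (force simp: child_gaps_def)
    have top0: "child_top u a 0 = Suc (Suc a)"
      using A(4) by (simp add: child_top_def lift_gt)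
    show ?thesis
      unfolding state_E'_def gaps using A ap
      by (intro exI[of _ "Suc a"] exI[of _ "Suc ` P"])
        (auto simp: card_image top top0 less_imp_le Suc_le_eq less_Suc_eq_le)
  qed
  moreover have "state_F (card {h \<in> P. p \<le> h}) (child_gaps n A u p) (child_top u p)"
    if p: "p \<in> P" for p
  proof -
    have gaps: "child_gaps n A u p = Suc ` {h \<in> P. p \<le> h}"
      using A(1) A(5)[OF p] A(6)[of p] A(7)[of p] ap p by (force simp: child_gaps_def)
    have top0: "child_top u p 0 = u 0"
      using A(5)[OF p] by (simp add: child_top_def lift_le)
    show ?thesis
      unfolding state_F_def gaps using A p by (auto simp: card_image top top0 intro: le_SucI)
  qed
  moreover have "a \<notin> P"
    using ap by blast
  ultimately show ?thesis
    using that A by blast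
qed

text \<open>Only \<open>c\<close> has no ascent above it. A letter there keeps \<open>a\<close> but
  loses \<open>P\<close>, which is not below \<open>u 0\<close>. A letter at \<open>p\<close> in
  \<open>P\<close> loses \<open>a\<close>, and \<open>c\<close> remains beside the upper part of
  \<open>P\<close>, whence the \<open>Suc\<close> in the F parameter.\<close>

lemma children_E:
  assumes "state_E k n A u"
  obtains a P c where "A = insert a (insert c P)" "a \<notin> P" "a \<noteq> c" "c \<notin> P" "finite P" "Suc (card P) = k"
    "state_E k (Suc n) (child_gaps n A u a) (child_top u a)"
    "state_E 1 (Suc n) (child_gaps n A u c) (child_top u c)"
    "\<And>p. p \<in> P \<Longrightarrow> state_F (Suc (card {h \<in> P. p \<le> h})) (child_gaps n A u p) (child_top u p)"
proof -
  obtain a P c where A: "A = insert a (insert c P)" "finite P" "Suc (card P) = k" "a < u 0" "u 0 \<le> c"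
    "\<And>p. p \<in> P \<Longrightarrow> u 0 \<le> p \<and> p < c"
    "\<And>h. h \<in> insert a P \<Longrightarrow> c < u h \<and> u h \<le> n" "u c = Suc n"
    using assms unfolding state_E_def by blast
  have ap: "a < p" if "p \<in> P" for p
    using A(4) A(6)[OF that] by linarith
  have "c < u a" "u a \<le> n"
    using A(7) by auto
  then have cn: "c < n" "a < c" "c < u a" "u a \<le> n"
    using A(4,5) by linarith+
  have u: "h' < u h" if "h \<in> A" "h' \<in> A" for h h'
    using that A(1) A(6)[of h] A(6)[of h'] A(7)[of h] A(8) cn by auto
  have top: "child_top u g (Suc h) = Suc (u h)" if "h \<in> A" "g \<in> A" "g \<le> h" for g h
    using u[OF that(1,2)] that by (simp add: child_top_def lift_gt)
  have first: "state_E k (Suc n) (child_gaps n A u a) (child_top u a)"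
  proof -
    have gaps: "child_gaps n A u a = insert (Suc a) (insert (Suc c) (Suc ` P))"
      using A(1-6) ap cn u[of a] by (auto simp: child_gaps_def inj_image_mem_iff intro: less_imp_le)
    have top0: "child_top u a 0 = Suc (Suc a)"
      using A(4) by (simp add: child_top_def lift_gt)
    show ?thesis
      unfolding state_E_def gaps using A ap cn
      by (intro exI[of _ "Suc a"] exI[of _ "Suc ` P"] exI[of _ "Suc c"])
        (auto simp: card_image top top0 less_imp_le Suc_le_eq less_Suc_eq_le)
  qed
  have last: "state_E 1 (Suc n) (child_gaps n A u c) (child_top u c)"
  proof -
    have gaps: "child_gaps n A u c = insert a (insert (Suc c) {})"
      using A ap cn by (fastforce simp: child_gaps_def)
    have "child_top u c 0 = u 0" "child_top u c a = c + 2"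
      using A(5) cn by (auto simp: child_top_def lift_le lift_gt)
    then show ?thesis
      unfolding state_E_def gaps using A(1,4,5,8) cn(1,2) top[of c c]
      by (intro exI[of _ a] exI[of _ "{}"] exI[of _ "Suc c"]) auto
  qed
  have mid: "state_F (Suc (card {h \<in> P. p \<le> h})) (child_gaps n A u p) (child_top u p)"
    if p: "p \<in> P" for p
  proof -
    have gaps: "child_gaps n A u p = Suc ` insert c {h \<in> P. p \<le> h}"
      using A(7)[of p] A(1-6) u[of p] ap p by (force simp: child_gaps_def)
    have top0: "child_top u p 0 = u 0"
      using A(6)[OF p] by (simp add: child_top_def lift_le)
    have "u 0 \<le> Suc h" if "h \<in> insert c P" for h
      using A(5) A(6)[of h] that by auto
    moreover have "c \<notin> P" "p \<le> c" using A(6) p by force+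
    ultimately show ?thesis
      unfolding state_F_def gaps using A(1,2) p u
      by (auto simp: card_image top top0 inj_image_mem_iff)
  qed
  show ?thesis
    using that[OF A(1) _ _ _ A(2,3) first last mid] ap cn A(6) by blast
qed

text \<open>A letter in \<open>L\<close> cuts everything from \<open>u 0\<close> on, hence
  \<open>R\<close>; a letter at \<open>b\<close> leaves \<open>b\<close> alone because
  \<open>R\<close> starts at \<open>u b\<close>; a letter in \<open>R\<close> has no ascent above it
  and preserves \<open>L\<close> and \<open>b\<close>.\<close>

lemma children_G:
  assumes "state_G i r n A u"
  obtains L b R where "A = L \<union> insert b R" "finite L" "finite R" "card L = i" "card R = r"
    "b \<notin> L" "b \<notin> R" "L \<inter> R = {}"
    "\<And>l. l \<in> L \<Longrightarrow> state_E' (card {h \<in> L. l \<le> h}) (Suc n) (child_gaps n A u l) (child_top u l)"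
    "state_E' 0 (Suc n) (child_gaps n A u b) (child_top u b)"
    "\<And>c. c \<in> R \<Longrightarrow> state_G i (card {h \<in> R. c \<le> h}) (Suc n) (child_gaps n A u c) (child_top u c)"
proof -
  obtain L b R where A: "A = L \<union> insert b R" "finite L" "finite R" "card L = i" "card R = r" "R \<noteq> {}"
    "b < u 0" "u 0 \<le> u b" "\<And>l. l \<in> L \<Longrightarrow> l < b \<and> u l = u 0"
    "\<And>h. h \<in> R \<Longrightarrow> u b \<le> h \<and> h \<le> n \<and> u h = Suc n"
    using assms unfolding state_G_def by blast
  have ub: "u b \<le> n" "u 0 \<le> n"
    using A(6,8,10) by force+
  have R: "b < h" "u 0 \<le> h" if "h \<in> R" for h
    using A(7,8) A(10)[OF that] by linarith+
  have L: "h < b" "h < u 0" if "h \<in> L" for h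
    using A(7) A(9)[OF that] by linarith+
  have E': "state_E' (card {h \<in> L. l \<le> h}) (Suc n) (child_gaps n A u l) (child_top u l)"
    if l: "l \<in> L" for l
  proof -
    \<comment> \<open>The gap \<open>l\<close> becomes the distinguished gap of the E' state, and
      \<open>b\<close> replaces it in the count.\<close>
    define P where "P = {h \<in> L. l < h} \<union> {b}"
    have gaps: "child_gaps n A u l = insert (Suc l) (Suc ` P)"
      using A(1,7,8) A(9)[OF l] ub R l L L(1)[OF l, THEN less_imp_le]
      by (auto simp: child_gaps_def P_def inj_image_mem_iff intro: less_imp_le dest: A(10))
    have "{h \<in> L. l \<le> h} = insert l {h \<in> L. l < h}"
      using l by force
    moreover have "b \<notin> L" using A(9) by blast
    ultimately have card: "card (Suc ` P) = card {h \<in> L. l \<le> h}"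
      using A(2) by (simp add: card_image inj_image_mem_iff P_def)
    have top0: "child_top u l 0 = l + 2"
      using A(7) A(9)[OF l] by (auto simp: child_top_def lift_gt)
    have topL: "child_top u l (Suc h) = Suc (u 0)" if "h \<in> L" "l \<le> h" for h
      using A(7) A(9)[OF l] A(9)[OF that(1)] that by (auto simp: child_top_def lift_gt)
    have topb: "child_top u l (Suc b) = Suc (u b)"
      using A(7,8) A(9)[OF l] by (auto simp: child_top_def lift_gt)
    have Pb: "p \<le> b" "l < p" "child_top u l (Suc p) \<le> Suc n" "Suc b < child_top u l (Suc p)"
      if "p \<in> P" for p
      using that A(7,8) A(9)[OF l] ub by (auto simp: P_def topL topb dest: A(9))
    have Pt: "Suc p' < child_top u l (Suc p)" if "p \<in> P" "p' \<in> P" for p p'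
      using Pb(4)[OF that(1)] Pb(1)[OF that(2)] by simp
    have "finite P"
      using A(2) by (simp add: P_def)
    then show ?thesis
      unfolding state_E'_def gaps card[symmetric] using A(2,7) A(9)[OF l] l ub
      by (intro exI[of _ "Suc l"] exI[of _ "Suc ` P"])
        (auto simp: top0 topL P_def[symmetric] Suc_le_eq less_Suc_eq_le dest: Pb Pt)
  qed
  have E'0: "state_E' 0 (Suc n) (child_gaps n A u b) (child_top u b)"
  proof -
    have gaps: "child_gaps n A u b = {Suc b}"
      using A(1,7,8) ub by (fastforce simp: child_gaps_def dest: A(9) A(10))
    have "child_top u b 0 = b + 2" "child_top u b (Suc b) = Suc (u b)"
      using A(7,8) by (auto simp: child_top_def lift_gt)
    then show ?thesis
      unfolding state_E'_def gaps using A(7,8) ub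
      by (intro exI[of _ "Suc b"] exI[of _ "{}"]) auto
  qed
  have G: "state_G i (card {h \<in> R. c \<le> h}) (Suc n) (child_gaps n A u c) (child_top u c)"
    if c: "c \<in> R" for c
  proof -
    have gaps: "child_gaps n A u c = L \<union> insert b (Suc ` {h \<in> R. c \<le> h})"
      using A(1,7) A(10)[OF c] R[OF c]
      by (auto simp: child_gaps_def inj_image_mem_iff less_Suc_eq_le dest: L A(10) R)
    have top: "child_top u c 0 = u 0" "child_top u c b = u b" "\<And>l. l \<in> L \<Longrightarrow> child_top u c l = u 0"
      "\<And>h. h \<in> R \<Longrightarrow> c \<le> h \<Longrightarrow> child_top u c (Suc h) = Suc (Suc n)"
      using A(7,8) R[OF c] A(10)[OF c] A(9,10)
      by (force simp: child_top_def lift_gt lift_le)+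
    show ?thesis
      unfolding state_G_def gaps using A(2-8) R c
      by (intro exI[of _ L] exI[of _ b] exI[of _ "Suc ` {h \<in> R. c \<le> h}"])
        (auto simp: card_image top dest: A(9) A(10))
  qed
  show ?thesis
    using that[OF A(1-5) _ _ _ E' E'0 G] A(9) R by fastforce
qed

text \<open>Compared with G there is a gap \<open>c\<close> just below the top \<open>u b\<close>.
  It survives a letter at \<open>b\<close>, giving E(1). A letter at \<open>c\<close> moves
  \<open>c\<close> and \<open>u b\<close> up together, so the state reproduces itself. A letter in
  \<open>R\<close> removes \<open>c\<close>, which is not below \<open>u 0\<close>, and leaves a G
  state.\<close>

lemma children_C:
  assumes "state_C i r n A u"
  obtains L b c R where "A = L \<union> insert b (insert c R)" "finite L" "finite R" "card L = i" "card R = r"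
    "b \<notin> L" "c \<notin> L" "b \<noteq> c" "b \<notin> R" "c \<notin> R" "L \<inter> R = {}"
    "\<And>l. l \<in> L \<Longrightarrow> state_E' (card {h \<in> L. l \<le> h}) (Suc n) (child_gaps n A u l) (child_top u l)"
    "state_E 1 (Suc n) (child_gaps n A u b) (child_top u b)"
    "state_C i r (Suc n) (child_gaps n A u c) (child_top u c)"
    "\<And>d. d \<in> R \<Longrightarrow> state_G i (card {h \<in> R. d \<le> h}) (Suc n) (child_gaps n A u d) (child_top u d)"
proof -
  obtain L b c R where A: "A = L \<union> insert b (insert c R)" "finite L" "finite R"
    "card L = i" "card R = r" "R \<noteq> {}"
    "b < u 0" "u 0 \<le> c" "u b = Suc c" "\<And>l. l \<in> L \<Longrightarrow> l < b \<and> u l = u 0"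
    "u c = Suc n" "\<And>h. h \<in> R \<Longrightarrow> c < h \<and> h \<le> n \<and> u h = Suc n"
    using assms unfolding state_C_def by blast
  have cn: "c < n" "u 0 \<le> n" "b < c" "b \<le> c"
    using A(6,7,8,12) by force+
  have L: "h < b" "h < u 0" "h < c" if "h \<in> L" for h
    using A(7,8) A(10)[OF that] by linarith+
  have R: "b < h" "u 0 \<le> h" if "h \<in> R" for h
    using A(7,8) A(12)[OF that] by linarith+
  have E': "state_E' (card {h \<in> L. l \<le> h}) (Suc n) (child_gaps n A u l) (child_top u l)"
    if l: "l \<in> L" for l
  proof -
    define P where "P = {h \<in> L. l < h} \<union> {b}"
    have gaps: "child_gaps n A u l = insert (Suc l) (Suc ` P)"
      using A(1,7,8) A(10)[OF l] cn R l L L(1)[OF l, THEN less_imp_le]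
      by (auto simp: child_gaps_def P_def inj_image_mem_iff intro: less_imp_le dest: A(12))
    have "{h \<in> L. l \<le> h} = insert l {h \<in> L. l < h}"
      using l by force
    moreover have "b \<notin> L" using A(10) by blast
    ultimately have card: "card (Suc ` P) = card {h \<in> L. l \<le> h}"
      using A(2) by (simp add: card_image inj_image_mem_iff P_def)
    have top0: "child_top u l 0 = l + 2"
      using A(7) A(10)[OF l] by (auto simp: child_top_def lift_gt)
    have topL: "child_top u l (Suc h) = Suc (u 0)" if "h \<in> L" "l \<le> h" for h
      using A(7) A(10)[OF l] A(10)[OF that(1)] that by (auto simp: child_top_def lift_gt)
    have topb: "child_top u l (Suc b) = Suc (u b)"
      using A(7-9) A(10)[OF l] by (auto simp: child_top_def lift_gt)
    have Pb: "p \<le> b" "l < p" "child_top u l (Suc p) \<le> Suc n" "Suc b < child_top u l (Suc p)"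
      if "p \<in> P" for p
      using that A(7-9) A(10)[OF l] cn by (auto simp: P_def topL topb dest: A(10))
    have Pt: "Suc p' < child_top u l (Suc p)" if "p \<in> P" "p' \<in> P" for p p'
      using Pb(4)[OF that(1)] Pb(1)[OF that(2)] by simp
    have "finite P"
      using A(2) by (simp add: P_def)
    then show ?thesis
      unfolding state_E'_def gaps card[symmetric] using A(2,7) A(10)[OF l] l cn
      by (intro exI[of _ "Suc l"] exI[of _ "Suc ` P"])
        (auto simp: top0 topL P_def[symmetric] Suc_le_eq less_Suc_eq_le dest: Pb Pt)
  qed
  have E: "state_E 1 (Suc n) (child_gaps n A u b) (child_top u b)"
  proof -
    have gaps: "child_gaps n A u b = {Suc b, Suc c}"
      using A(1,7-9) cn by (fastforce simp: child_gaps_def dest: A(10) A(12))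
    have "child_top u b 0 = b + 2" "child_top u b (Suc b) = Suc (Suc c)"
      "child_top u b (Suc c) = Suc (Suc n)"
      using A(7-9,11) cn by (auto simp: child_top_def lift_gt)
    then show ?thesis
      unfolding state_E_def gaps using A(7,8) cn
      by (intro exI[of _ "Suc b"] exI[of _ "{}"] exI[of _ "Suc c"]) auto
  qed
  have C: "state_C i r (Suc n) (child_gaps n A u c) (child_top u c)"
  proof -
    have gaps: "child_gaps n A u c = L \<union> insert b (insert (Suc c) (Suc ` R))"
      using A(1,7,8,11) cn
      by (auto simp: child_gaps_def inj_image_mem_iff less_Suc_eq_le intro: less_imp_le dest: L A(12) R)
    have top: "child_top u c 0 = u 0" "child_top u c b = c + 2"
      using A(8,9) cn by (auto simp: child_top_def lift_gt lift_le)
    have topL: "child_top u c l = u 0" if "l \<in> L" for l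
      using A(8) A(10)[OF that] L(3)[OF that] by (simp add: child_top_def lift_le)
    have topR: "child_top u c (Suc h) = Suc (Suc n)" if "h \<in> insert c R" for h
      using A(11) A(12)[of h] that cn by (auto simp: child_top_def lift_gt)
    show ?thesis
      unfolding state_C_def gaps using A(2-9) R cn
      by (intro exI[of _ L] exI[of _ b] exI[of _ "Suc c"] exI[of _ "Suc ` R"])
        (auto simp: card_image top topL topR dest: A(10) A(12))
  qed
  have G: "state_G i (card {h \<in> R. d \<le> h}) (Suc n) (child_gaps n A u d) (child_top u d)"
    if d: "d \<in> R" for d
  proof -
    have gaps: "child_gaps n A u d = L \<union> insert b (Suc ` {h \<in> R. d \<le> h})"
      using A(1,7,8) A(12)[OF d] R[OF d]
      by (auto simp: child_gaps_def inj_image_mem_iff less_Suc_eq_le dest: L A(12) R)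
    have top: "child_top u d 0 = u 0" "child_top u d b = Suc c"
      using A(7-9) R[OF d] A(12)[OF d] by (auto simp: child_top_def lift_le)
    have topL: "child_top u d l = u 0" if "l \<in> L" for l
      using A(10)[OF that] R[OF d] by (simp add: child_top_def lift_le)
    have topR: "child_top u d (Suc h) = Suc (Suc n)" if "h \<in> R" "d \<le> h" for h
      using A(12)[OF that(1)] A(12)[OF d] that by (simp add: child_top_def lift_gt)
    show ?thesis
      unfolding state_G_def gaps using A(2-9) R d cn
      by (intro exI[of _ L] exI[of _ b] exI[of _ "Suc ` {h \<in> R. d \<le> h}"])
        (auto simp: card_image top topL topR dest: A(10) A(12))
  qed
  have "b \<notin> L" "c \<notin> L" "b \<noteq> c" "b \<notin> R" "c \<notin> R" "L \<inter> R = {}"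
    using A(10,12) L R cn by fastforce+
  then show ?thesis
    using that[OF A(1-5) _ _ _ _ _ _ E' E C G] by blast
qed

text \<open>A letter in \<open>L\<close> makes \<open>b\<close>, which has no ascent above it, the
  gap \<open>c\<close> of an E state. A letter at \<open>d\<close> in \<open>R\<close> creates an
  ascent with top \<open>d + 2\<close>, the lowest above \<open>b\<close>; this is the condition
  \<open>u b = Suc c\<close> of a C state with \<open>c = Suc d\<close>.\<close>

lemma children_B:
  assumes "state_B i j n A u"
  obtains L b R where "A = L \<union> insert b (insert n R)" "finite L" "finite R"
    "card L = i" "Suc (card R) = j"
    "b \<notin> L" "n \<notin> L" "b \<noteq> n" "b \<notin> R" "n \<notin> R" "L \<inter> R = {}"
    "\<And>l. l \<in> L \<Longrightarrow> state_E (card {h \<in> L. l \<le> h}) (Suc n) (child_gaps n A u l) (child_top u l)"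
    "state_B (Suc i) j (Suc n) (child_gaps n A u b) (child_top u b)"
    "state_B i 1 (Suc n) (child_gaps n A u n) (child_top u n)"
    "\<And>d. d \<in> R \<Longrightarrow> state_C i (card {h \<in> R. d \<le> h}) (Suc n) (child_gaps n A u d) (child_top u d)"
proof -
  obtain L b R where A: "A = L \<union> insert b (insert n R)" "finite L" "finite R"
    "card L = i" "Suc (card R) = j"
    "b < u 0" "u 0 \<le> n" "\<And>l. l \<in> L \<Longrightarrow> l < b \<and> u l = u 0"
    "u b = Suc n" "u n = Suc n" "\<And>h. h \<in> R \<Longrightarrow> u 0 \<le> h \<and> h < n \<and> u h = Suc n"
    using assms unfolding state_B_def by blast
  have bn: "b < n" "b \<le> n"
    using A(6,7) by linarith+
  have L: "h < b" "h < u 0" "h < n" if "h \<in> L" for h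
    using A(6,7) A(8)[OF that] by linarith+
  have R: "b < h" "u 0 \<le> h" if "h \<in> R" for h
    using A(6) A(11)[OF that] by linarith+
  have E: "state_E (card {h \<in> L. l \<le> h}) (Suc n) (child_gaps n A u l) (child_top u l)"
    if l: "l \<in> L" for l
  proof -
    define P where "P = {h \<in> L. l < h}"
    have gaps: "child_gaps n A u l = insert (Suc l) (insert (Suc b) (Suc ` P))"
      using A(1,6,7) A(8)[OF l] R l L L(1)[OF l, THEN less_imp_le]
      by (auto simp: child_gaps_def P_def inj_image_mem_iff intro: less_imp_le dest: A(11))
    have "{h \<in> L. l \<le> h} = insert l {h \<in> L. l < h}"
      using l by force
    then have card: "Suc (card (Suc ` P)) = card {h \<in> L. l \<le> h}"
      using A(2) by (simp add: card_image P_def)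
    have top0: "child_top u l 0 = l + 2"
      using A(6) A(8)[OF l] by (auto simp: child_top_def lift_gt)
    have topL: "child_top u l (Suc h) = Suc (u 0)" if "h \<in> L" "l \<le> h" for h
      using A(6) A(8)[OF l] A(8)[OF that(1)] that by (auto simp: child_top_def lift_gt)
    have topb: "child_top u l (Suc b) = Suc (Suc n)"
      using A(9) bn A(8)[OF l] by (auto simp: child_top_def lift_gt)
    show ?thesis
      unfolding state_E_def gaps card[symmetric] using A(2,6,7) A(8)[OF l] l
      by (intro exI[of _ "Suc l"] exI[of _ "Suc ` P"] exI[of _ "Suc b"])
        (auto simp: top0 topL topb P_def Suc_le_eq less_Suc_eq_le dest: L)
  qed
  have B1: "state_B (Suc i) j (Suc n) (child_gaps n A u b) (child_top u b)"
  proof -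
    have gaps: "child_gaps n A u b = insert b L \<union> insert (Suc b) (insert (Suc n) (Suc ` R))"
      using A(1,6,9) bn
      by (auto simp: child_gaps_def inj_image_mem_iff less_Suc_eq_le intro: less_imp_le dest: L A(11) R)
    have top0: "child_top u b 0 = b + 2"
      using A(6) by (simp add: child_top_def lift_gt)
    have topL: "child_top u b l = b + 2" if "l \<in> insert b L" for l
      using A(6,9) A(8)[of l] bn that by (auto simp: child_top_def lift_gt)
    have topR: "child_top u b (Suc h) = Suc (Suc n)" if "h \<in> insert b (insert n R)" for h
      using A(9-10) A(11)[of h] R(1)[of h] bn that by (auto simp: child_top_def lift_gt)
    have "b \<notin> L"
      using L(1) by blast
    then have card: "card (insert b L) = Suc i" "Suc (card (Suc ` R)) = j"
      using A(2,4,5) by (auto simp: card_image)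
    have lt: "\<forall>l\<in>insert b L. l < Suc b \<and> child_top u b l = child_top u b 0"
      using L(1) topL top0 by (auto intro: less_SucI)
    have R': "\<forall>h\<in>Suc ` R. b + 2 \<le> h \<and> h < Suc n \<and> child_top u b h = Suc (Suc n)"
      using R(1) A(11) topR by force
    show ?thesis
      unfolding state_B_def gaps using A(2,3) card lt R' bn topR[of b] topR[of n] top0
      by - (rule exI[of _ "insert b L"], rule exI[of _ "Suc b"], rule exI[of _ "Suc ` R"], simp)
  qed
  have B2: "state_B i 1 (Suc n) (child_gaps n A u n) (child_top u n)"
  proof -
    have gaps: "child_gaps n A u n = L \<union> insert b (insert (Suc n) {})"
      using A(1,6,7,10) bn
      by (auto simp: child_gaps_def inj_image_mem_iff less_Suc_eq_le intro: less_imp_le dest: L A(11) R)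
    have top: "child_top u n 0 = u 0"
      "child_top u n b = Suc (Suc n)" "child_top u n (Suc n) = Suc (Suc n)"
      using A(7,9,10) bn by (auto simp: child_top_def lift_gt lift_le)
    have topL: "child_top u n l = u 0" if "l \<in> L" for l
      using A(7) A(8)[OF that] L(3)[OF that] by (simp add: child_top_def lift_le)
    show ?thesis
      unfolding state_B_def gaps using A(2-7) bn L
      by (intro exI[of _ L] exI[of _ b] exI[of _ "{}"]) (auto simp: top topL)
  qed
  have C: "state_C i (card {h \<in> R. d \<le> h}) (Suc n) (child_gaps n A u d) (child_top u d)"
    if d: "d \<in> R" for d
  proof -
    \<comment> \<open>The gap \<open>d\<close> turns into \<open>c\<close> of the C state, and the
      topmost gap \<open>n\<close> replaces it in the count.\<close>
    define Q where "Q = insert n {h \<in> R. d < h}"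
    have "{h \<in> R. d \<le> h} = insert d {h \<in> R. d < h}"
      using d by force
    moreover have "n \<notin> R" using A(11) by blast
    ultimately have card: "card (Suc ` Q) = card {h \<in> R. d \<le> h}"
      using A(3) by (simp add: card_image inj_image_mem_iff Q_def)
    have Q: "d < h" "h \<le> n" "h \<in> insert n R" if "h \<in> Q" for h
      using that A(11)[OF d] by (auto simp: Q_def dest: A(11))
    have gaps: "child_gaps n A u d = L \<union> insert b (insert (Suc d) (Suc ` Q))"
      using A(1,6,7) A(11)[OF d] R[OF d] d
      by (auto simp: child_gaps_def Q_def inj_image_mem_iff less_Suc_eq_le intro: less_imp_le
          dest: L A(11) R)
    have top: "child_top u d 0 = u 0" "child_top u d b = Suc (Suc d)"
      "child_top u d (Suc d) = Suc (Suc n)"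
      using A(9) R[OF d] A(11)[OF d] by (auto simp: child_top_def lift_gt lift_le)
    have topL: "child_top u d l = u 0" if "l \<in> L" for l
      using A(8)[OF that] R[OF d] by (simp add: child_top_def lift_le)
    have topQ: "child_top u d (Suc h) = Suc (Suc n)" if "h \<in> Q" for h
      using A(10) A(11)[of h] A(11)[OF d] Q[OF that] by (auto simp: child_top_def lift_gt)
    have "finite Q" "Q \<noteq> {}" using A(3) by (auto simp: Q_def)
    then show ?thesis
      unfolding state_C_def gaps card[symmetric] using A(2,4,6) A(11)[OF d]
      by (intro exI[of _ L] exI[of _ b] exI[of _ "Suc d"] exI[of _ "Suc ` Q"])
        (auto simp: top topL topQ dest: A(8) Q)
  qed
  have "b \<notin> L" "n \<notin> L" "b \<noteq> n" "b \<notin> R" "n \<notin> R" "L \<inter> R = {}"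
    using A(11) L R bn by fastforce+
  then show ?thesis
    using that[OF A(1-5) _ _ _ _ _ _ E B1 B2 C] by blast
qed

lemma children_D:
  assumes "state_D n A u"
  shows "A = {0..n}"
    and "state_D (Suc n) (child_gaps n A u n) (child_top u n)"
    and "g < n \<Longrightarrow> state_B (Suc g) (n - g) (Suc n) (child_gaps n A u g) (child_top u g)"
proof -
  show A: "A = {0..n}"
    using assms by (simp add: state_D_def)
  have u: "u h = Suc n" if "h \<le> n" for h
    using assms that by (simp add: state_D_def)
  have gaps: "child_gaps n A u g = {0..Suc n}" if "g \<le> n" for g
  proof -
    have "{h \<in> A. h \<le> g \<and> n < u g \<and> h < u 0} = {0..g}" "{h \<in> A. g \<le> h \<and> h < u g} = {g..n}"
      using that by (auto simp: A u)
    then have "child_gaps n A u g = {0..g} \<union> {Suc g..Suc n}"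
      by (simp only: child_gaps_def image_Suc_atLeastAtMost)
    also have "\<dots> = {0..Suc n}"
      using that by auto
    finally show ?thesis .
  qed
  have top1: "child_top u g h = g + 2" if "g \<le> n" "h \<le> g" for g h
    using that by (simp add: child_top_def u lift_gt)
  have top2: "child_top u g (Suc h) = Suc (Suc n)" if "g \<le> h" "h \<le> n" for g h
    using that by (simp add: child_top_def u lift_gt)
  have "child_top u n h = Suc (Suc n)" if "h \<le> Suc n" for h
    using that top1[of n h] top2[of n n] by (cases "h = Suc n") simp_all
  then show "state_D (Suc n) (child_gaps n A u n) (child_top u n)"
    by (simp add: state_D_def gaps)
  show "state_B (Suc g) (n - g) (Suc n) (child_gaps n A u g) (child_top u g)" if g: "g < n"
  proof -
    \<comment> \<open>The first ascent created has lowest top \<open>g + 2\<close>, which separates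
      \<open>L\<close> and \<open>b = Suc g\<close> from the upper gaps.\<close>
    have "{0..Suc n} = {0..g} \<union> insert (Suc g) (insert (Suc n) {g+2..n})"
      using g by auto
    moreover have "child_top u g h = Suc (Suc n)" if "h \<in> {g+2..n}" for h
      using that top2[of g "h - 1"] by (cases h) auto
    ultimately show ?thesis
      unfolding state_B_def gaps[OF less_imp_le[OF g]] using g
      by - (rule exI[of _ "{0..g}"], rule exI[of _ "Suc g"], rule exI[of _ "{g+2..n}"],
        simp add: top1 top2)
  qed
qed

section \<open>Generating functions of the families\<close>

definition al :: "rat fps" where "al = inverse (1 - fps_X)"
definition be :: "rat fps" where "be = inverse (1 - 2 * fps_X)"
definition ga :: "rat fps" where "ga = inverse (1 - 3 * fps_X + fps_X ^ 2)"

lemma al_eq: "al * (1 - fps_X) = 1"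
  unfolding al_def by (rule inverse_mult_eq_1) simp
lemma be_eq: "be * (1 - 2 * fps_X) = 1"
  unfolding be_def by (rule inverse_mult_eq_1) simp
lemma ga_eq: "ga * (1 - 3 * fps_X + fps_X ^ 2) = 1"
  unfolding ga_def by (rule inverse_mult_eq_1) simp

lemma al_unfold: "al = 1 + fps_X * al"
  using al_eq by algebra

text \<open>Telescoping form of \<open>fps_X * al = al - 1\<close>; it collapses all geometric sums
  below.\<close>

lemma fps_X_power_al: "fps_X * al ^ Suc k = al ^ Suc k - al ^ k"
proof -
  have "al ^ Suc k - fps_X * al ^ Suc k = (al * (1 - fps_X)) * al ^ k"
    by (simp add: algebra_simps)
  then show ?thesis
    unfolding al_eq by (simp add: algebra_simps)
qed

lemma power_al_Suc: "al ^ Suc k = al ^ k + fps_X * al ^ Suc k"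
  unfolding fps_X_power_al by simp

lemma sum_power_al: "fps_X * (\<Sum>k=1..n. al ^ (k + s)) = al ^ (n + s) - al ^ s"
proof (induction n)
  case (Suc n)
  then show ?case
    using fps_X_power_al[of "n + s"] by (simp add: distrib_left)
qed simp

text \<open>The series of the families are linear combinations of powers of \<open>al\<close> with coefficients that are
  polynomial in the parameters; the constants below solve the equations that result from inserting
  this ansatz into the succession rules. The families \<open>F(k)\<close>, \<open>E'(k)\<close> and \<open>G(i,r)\<close> have the series
  \<open>al ^ k\<close>, \<open>al ^ (k + 1)\<close> and \<open>al ^ (i + r + 1)\<close>.\<close>

definition gf_c where "gf_c = fps_X ^ 2 * al ^ 2 * be"
definition gf_p where "gf_p = fps_X ^ 2 * al * be * ga"
definition gf_q1 where "gf_q1 = fps_X * gf_c * be"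
definition gf_q2 where "gf_q2 = fps_X * gf_c * al"
definition gf_q0 where
  "gf_q0 = be * (fps_X * gf_q1 + fps_X * gf_q2 - fps_X * al - fps_X * gf_c)"
definition gf_c2 where "gf_c2 = al * fps_X * (gf_q1 + gf_q2)"
definition gf_c1 where "gf_c1 = al * fps_X * (gf_c2 + gf_q0)"
definition gf_c0 where "gf_c0 = al * (1 - gf_p + fps_X * (gf_c1 + gf_c2))"
definition gf_a where "gf_a = fps_X ^ 2 * be ^ 3 + fps_X ^ 2 * be ^ 2 * ga"
definition gf_b where "gf_b = fps_X * be ^ 2"

definition gf_E :: "nat \<Rightarrow> rat fps" where
  "gf_E k = al ^ (k + 1) + gf_c"
definition gf_C :: "nat \<Rightarrow> nat \<Rightarrow> rat fps" where
  "gf_C i r = al ^ (i + r + 2) + gf_c"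
definition gf_B :: "nat \<Rightarrow> nat \<Rightarrow> rat fps" where
  "gf_B i j = gf_p * al ^ i + be * al ^ (i + j) + gf_q0 + of_nat i * gf_q1 + of_nat j * gf_q2"
definition gf_D :: "nat \<Rightarrow> rat fps" where
  "gf_D n = (gf_a + of_nat n * gf_b) * al ^ n + gf_c0 + of_nat n * gf_c1 + of_nat (\<Sum>k=1..n. k) * gf_c2"

section \<open>Verification of the ansatz\<close>

lemma gf_c_rec: "gf_c = 1 - al + fps_X * (gf_c + al ^ 2 + gf_c)"
  unfolding gf_c_def using al_eq be_eq by algebra

lemma gf_F_rec: "al ^ k = 1 + fps_X * (\<Sum>j=1..k. al ^ j)"
  using sum_power_al[of 0 k] by simp

lemma gf_E'_rec: "al ^ (k + 1) = 1 + fps_X * (al ^ (k + 1) + (\<Sum>j=1..k. al ^ j))"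
  using sum_power_al[of 0 k] fps_X_power_al[of k] by (simp add: distrib_left)

lemma gf_E_rec:
  "gf_E (Suc k) = 1 + fps_X * (gf_E (Suc k) + gf_E 1 + (\<Sum>j=1..k. al ^ (j + 1)))"
proof -
  have "y' + gf_c = 1 + (fps_X * (y' + gf_c) + fps_X * (al ^ 2 + gf_c) + (y - al))"
    if "y' = y + fps_X * y'" for y y'
    using that gf_c_rec by algebra
  from this[OF power_al_Suc[of "k + 1"]] show ?thesis
    unfolding gf_E_def one_add_one distrib_left[of fps_X] sum_power_al power_one_right add_Suc .
qed

lemma gf_C_rec:
  "gf_C i r = 1 + fps_X * ((\<Sum>k=1..i. al ^ (k + 1)) + gf_E 1 + gf_C i r + (\<Sum>k=1..r. al ^ (k + (i + 1))))"
proof -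
  have "y' + gf_c = 1 + ((z - al) + fps_X * (al ^ 2 + gf_c) + fps_X * (y' + gf_c) + (y - z))"
    if "y' = y + fps_X * y'" for y y' z
    using that gf_c_rec by algebra
  moreover have "al ^ (i + r + 2) = al ^ (r + (i + 1)) + fps_X * al ^ (i + r + 2)"
    using power_al_Suc[of "r + (i + 1)"] by (simp only: ac_simps add_2_eq_Suc' add_Suc_right One_nat_def add_0_right add_0)
  ultimately show ?thesis
    unfolding gf_E_def gf_C_def one_add_one distrib_left[of fps_X] sum_power_al power_one_right .
qed

lemma gf_G_rec:
  "al ^ (i + r + 1) = 1 + fps_X * ((\<Sum>k=1..i. al ^ (k + 1)) + al + (\<Sum>k=1..r. al ^ (k + (i + 1))))"
proof -
  have "y = 1 + ((z - al) + fps_X * al + (y - z))" for y z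
    using al_unfold by algebra
  from this[of "al ^ (r + (i + 1))" "al ^ (i + 1)"] show ?thesis
    unfolding distrib_left[of fps_X] sum_power_al power_one_right by (simp only: ac_simps)
qed

text \<open>Coefficient of \<open>al ^ i\<close> in the equation of B(i,j). The terms
  \<open>al\<close> and \<open>- al ^ 2\<close> stem from the E and C sums, the other three from
  B(i+1,j) and B(i,1). This is the source of \<open>ga\<close>, because
  \<open>1 - fps_X - fps_X * al = al * (1 - 3 * fps_X + fps_X ^ 2)\<close>.\<close>

lemma gf_p_rec: "gf_p = al - al ^ 2 + fps_X * be * al + fps_X * al * gf_p + fps_X * gf_p"
  unfolding gf_p_def using al_eq be_eq ga_eq by algebra

text \<open>Coefficient of the parameter \<open>i\<close>, which both B children carry.\<close>

lemma gf_q1_rec: "gf_q1 = fps_X * gf_c + 2 * fps_X * gf_q1"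
  unfolding gf_q1_def using be_eq by algebra

text \<open>Coefficient of \<open>j\<close>; only B(i+1,j) carries it, since B(i,1) resets
  it.\<close>

lemma gf_q2_rec: "gf_q2 = fps_X * gf_c + fps_X * gf_q2"
  unfolding gf_q2_def using al_eq by algebra

text \<open>Constant part. Here \<open>gf_q1\<close> comes from raising \<open>i\<close> by one,
  \<open>gf_q2\<close> from the parameter 1 of B(i,1), and \<open>- fps_X * gf_c\<close> from the C
  sum having \<open>j - 1\<close> terms only.\<close>

lemma gf_q0_rec:
  "gf_q0 = 1 - al - fps_X * gf_c + fps_X * (2 * gf_q0 + gf_q1 + gf_q2)"
  unfolding gf_q0_def using be_eq al_eq by algebra

lemma gf_B_rec:
  "gf_B i (Suc j) = 1 + fps_X * ((\<Sum>k=1..i. gf_E k) + gf_B (Suc i) (Suc j) + gf_B i 1 + (\<Sum>r=1..j. gf_C i r))"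
proof -
  have E: "fps_X * (\<Sum>k=1..i. gf_E k) = al ^ (i + 1) - al + of_nat i * (fps_X * gf_c)"
    using sum_power_al[of 1 i] by (simp add: gf_E_def sum.distrib distrib_left)
  have "(\<Sum>r=1..j. al ^ (i + r + 2)) = (\<Sum>k=1..j. al ^ (k + (i + 2)))"
    by (rule sum.cong) (auto simp: ac_simps)
  then have C: "fps_X * (\<Sum>r=1..j. gf_C i r) = al ^ (j + (i + 2)) - al ^ (i + 2) + of_nat j * (fps_X * gf_c)"
    using sum_power_al[of "i + 2" j] by (simp add: gf_C_def sum.distrib distrib_left)
  \<comment> \<open>Coefficient of \<open>al ^ (i + j)\<close>, fed by the C sum and by
    B(i+1,j).\<close>
  have b: "be = al + fps_X * al * be"
    using al_eq be_eq by algebra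
  \<comment> \<open>The powers \<open>al ^ i\<close>, \<open>al ^ j\<close> and the numbers
    \<open>i\<close>, \<open>j\<close> become free variables \<open>y\<close>, \<open>z\<close>,
    \<open>s\<close>, \<open>t\<close>, so that a polynomial identity remains.\<close>
  have key: "gf_p * y + be * (y * (z * al)) + gf_q0 + s * gf_q1 + (1 + t) * gf_q2 =
     1 + (y * al - al + s * (fps_X * gf_c)) +
     fps_X * ((gf_p * (al * y) + be * ((al * y) * (z * al)) + gf_q0 + (1 + s) * gf_q1 + (1 + t) * gf_q2) +
       (gf_p * y + be * (y * al) + gf_q0 + s * gf_q1 + gf_q2)) +
     (z * (y * al ^ 2) - y * al ^ 2 + t * (fps_X * gf_c))" for y z s t :: "rat fps"
    using gf_p_rec gf_q1_rec gf_q2_rec gf_q0_rec b by algebra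
  have "gf_B i (Suc j) = 1 + (al ^ (i + 1) - al + of_nat i * (fps_X * gf_c)) +
     fps_X * (gf_B (Suc i) (Suc j) + gf_B i 1) +
     (al ^ (j + (i + 2)) - al ^ (i + 2) + of_nat j * (fps_X * gf_c))"
    unfolding gf_B_def using key[of "al ^ i" "al ^ j" "of_nat i" "of_nat j"]
    by (simp only: of_nat_Suc power_add power_Suc power_one_right of_nat_1 mult_1 mult_1_right add_Suc add_Suc_right
        mult.assoc mult.commute mult.left_commute)
  then show ?thesis
    using E C by (simp add: distrib_left)
qed

text \<open>Each of the \<open>n\<close> children B(g+1,n-g) contributes the same power
  \<open>al ^ Suc n\<close>. This resonance forces a term with \<open>n * al ^ n\<close> in
  \<open>gf_D\<close>.\<close>

lemma gf_b_rec: "gf_b = fps_X * al * gf_b + fps_X * be * al"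
  unfolding gf_b_def using al_eq be_eq by algebra

lemma gf_a_rec: "gf_a = fps_X * al * (gf_a + gf_b) + gf_p"
  unfolding gf_a_def gf_b_def gf_p_def using al_eq be_eq ga_eq by algebra

text \<open>Both parameters of the B children of D(n) sum to the triangular number. The shift to
  D(n+1) passes \<open>gf_c2\<close> on to \<open>gf_c1\<close> and then to \<open>gf_c0\<close>,
  each time with a further factor \<open>al\<close>; so the sixth power of \<open>1 - fps_X\<close>
  arises.\<close>

lemma gf_c2_rec: "gf_c2 = fps_X * gf_c2 + fps_X * (gf_q1 + gf_q2)"
  unfolding gf_c2_def using al_eq by algebra

lemma gf_c1_rec: "gf_c1 = fps_X * gf_c1 + fps_X * gf_c2 + fps_X * gf_q0"
  unfolding gf_c1_def using al_eq by algebra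

lemma gf_c0_rec: "gf_c0 = 1 - gf_p + fps_X * (gf_c0 + gf_c1 + gf_c2)"
  unfolding gf_c0_def using al_eq by algebra

lemma gf_D_rec: "gf_D n = 1 + fps_X * ((\<Sum>g<n. gf_B (Suc g) (n - g)) + gf_D (Suc n))"
proof -
  define S :: "rat fps" where "S = of_nat (\<Sum>k=1..n. k)"
  have S1: "(\<Sum>g<n. of_nat (Suc g)) = S"
    unfolding S_def of_nat_sum
    by (rule sum.reindex_bij_witness[of _ "\<lambda>k. k - 1" Suc]) auto
  have S2: "(\<Sum>g<n. of_nat (n - g)) = S"
    unfolding S_def of_nat_sum
    by (rule sum.reindex_bij_witness[of _ "\<lambda>k. n - k" "\<lambda>k. n - k"]) auto
  have P: "fps_X * (\<Sum>g<n. al ^ Suc g) = al ^ n - 1"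
  proof -
    have "(\<Sum>g<n. al ^ Suc g) = (\<Sum>k=1..n. al ^ k)"
      by (rule sum.reindex_bij_witness[of _ "\<lambda>k. k - 1" Suc]) auto
    then show ?thesis
      using sum_power_al[of 0 n] by simp
  qed
  have "(\<Sum>g<n. gf_B (Suc g) (n - g)) =
    (\<Sum>g<n. gf_p * al ^ Suc g + be * al ^ Suc n + gf_q0 + of_nat (Suc g) * gf_q1 + of_nat (n - g) * gf_q2)"
    by (rule sum.cong) (auto simp: gf_B_def)
  also have "\<dots> = gf_p * (\<Sum>g<n. al ^ Suc g) + of_nat n * (be * al ^ Suc n) + of_nat n * gf_q0 +
    (\<Sum>g<n. of_nat (Suc g)) * gf_q1 + (\<Sum>g<n. of_nat (n - g)) * gf_q2"
    by (simp only: sum.distrib sum_distrib_left[symmetric] sum_distrib_right[symmetric]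
        sum_constant card_lessThan mult.left_commute)
  finally have B: "fps_X * (\<Sum>g<n. gf_B (Suc g) (n - g)) = gf_p * (al ^ n - 1) +
    fps_X * (of_nat n * (be * (al * al ^ n)) + of_nat n * gf_q0 + S * gf_q1 + S * gf_q2)"
    unfolding S1 S2 P[symmetric] by (simp add: algebra_simps)
  have D: "gf_D (Suc n) = (gf_a + (1 + of_nat n) * gf_b) * (al * al ^ n) + gf_c0 +
     (1 + of_nat n) * gf_c1 + (S + (1 + of_nat n)) * gf_c2"
    by (simp add: gf_D_def S_def)
  have key: "(gf_a + N * gf_b) * y + gf_c0 + N * gf_c1 + S * gf_c2 =
    1 + (gf_p * (y - 1) + fps_X * (N * (be * (al * y)) + N * gf_q0 + S * gf_q1 + S * gf_q2) +
    fps_X * ((gf_a + (1 + N) * gf_b) * (al * y) + gf_c0 + (1 + N) * gf_c1 + (S + (1 + N)) * gf_c2))"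
    for N y :: "rat fps"
    using gf_b_rec gf_a_rec gf_c2_rec gf_c1_rec gf_c0_rec by algebra
  show ?thesis
    unfolding distrib_left B D using key[of "of_nat n" "al ^ n"]
    by (simp add: gf_D_def S_def distrib_left)
qed

text \<open>Denominators are cleared one series at a time. \<open>A\<close>, \<open>B\<close> and
  \<open>G\<close> stay opaque, subject only to the inverse relations, and are expanded in the last
  polynomial identity.\<close>

lemma gf_D_0:
  fixes x :: "rat fps"
  defines "x \<equiv> fps_X"
  shows "gf_D 0 * ((1 - x)^6 * (1 - 2 * x)^3 * (1 - 3 * x + x^2)) =
    1 - 14 * x + 87 * x^2 - 315 * x^3 + 736 * x^4 - 1161 * x^5 + 1253 * x^6
       - 918 * x^7 + 446 * x^8 - 134 * x^9 + 18 * x^10"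
proof -
  define A B G where "A = 1 - x" and "B = 1 - 2 * x" and "G = 1 - 3 * x + x^2"
  note ABG = A_def B_def G_def
  have inv: "al * A = 1" "be * B = 1" "ga * G = 1"
    using al_eq be_eq ga_eq by (simp_all add: ABG x_def)
  have p: "gf_p * (A * B * G) = x ^ 2"
    unfolding gf_p_def x_def[symmetric] using inv by algebra
  have c: "gf_c * (A ^ 2 * B) = x ^ 2"
    unfolding gf_c_def x_def[symmetric] using inv by algebra
  have q1: "gf_q1 * (A ^ 2 * B ^ 2) = x ^ 3"
    unfolding gf_q1_def x_def[symmetric] using inv c by algebra
  have q2: "gf_q2 * (A ^ 3 * B) = x ^ 3"
    unfolding gf_q2_def x_def[symmetric] using inv c by algebra
  define q where "q = x ^ 4 * A + x ^ 4 * B - x * A ^ 2 * B ^ 2 - x ^ 3 * A * B"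
  have q0: "gf_q0 * (A ^ 3 * B ^ 3) = q"
    unfolding gf_q0_def x_def[symmetric] q_def using inv c q1 q2 by algebra
  have c2: "gf_c2 * (A ^ 4 * B ^ 2) = x ^ 4 * (A + B)"
    unfolding gf_c2_def x_def[symmetric] using inv q1 q2 by algebra
  define r where "r = x * (B * (x ^ 4 * (A + B)) + A * q)"
  have c1: "gf_c1 * (A ^ 5 * B ^ 3) = r"
    unfolding gf_c1_def x_def[symmetric] r_def using inv c2 q0 by algebra
  have c0: "gf_c0 * (A ^ 6 * B ^ 3 * G) =
    A ^ 5 * B ^ 3 * G - x ^ 2 * A ^ 4 * B ^ 2 + x * G * (r + A * B * (x ^ 4 * (A + B)))"
    unfolding gf_c0_def x_def[symmetric] using inv p c1 c2 by algebra
  have a: "gf_a * (B ^ 3 * G) = x ^ 2 * G + x ^ 2 * B"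
    unfolding gf_a_def x_def[symmetric] using inv by algebra
  have "gf_D 0 * (A ^ 6 * B ^ 3 * G) = A ^ 6 * (x ^ 2 * G + x ^ 2 * B) +
    (A ^ 5 * B ^ 3 * G - x ^ 2 * A ^ 4 * B ^ 2 + x * G * (r + A * B * (x ^ 4 * (A + B))))"
    unfolding c0[symmetric] a[symmetric] by (simp add: gf_D_def algebra_simps)
  also have "\<dots> = 1 - 14 * x + 87 * x^2 - 315 * x^3 + 736 * x^4 - 1161 * x^5 + 1253 * x^6
       - 918 * x^7 + 446 * x^8 - 134 * x^9 + 18 * x^10"
    unfolding r_def q_def ABG by algebra
  finally show ?thesis
    unfolding ABG .
qed

section \<open>Tree counts as coefficients\<close>

unbundle fps_syntax

text \<open>Descending one level of the tree corresponds to passing from \<open>f\<close> to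
  \<open>g\<close>; this drives the inductions on the depth.\<close>

lemma fps_rec_nth:
  fixes f g :: "'a::comm_ring_1 fps"
  assumes "f = 1 + fps_X * g"
  shows "f $ 0 = 1" "f $ Suc m = g $ m"
  by (simp_all add: assms)

lemma of_nat_tree_count_Suc:
  "(of_nat (tree_count (Suc m) n A u) :: rat) =
     (\<Sum>g\<in>A. of_nat (tree_count m (Suc n) (child_gaps n A u g) (child_top u g)))"
  by simp

lemma count_F: "state_F k A u \<Longrightarrow> of_nat (tree_count m n A u) = (al ^ k) $ m"
proof (induction m arbitrary: k n A u)
  case 0
  show ?case
    using fps_rec_nth(1)[OF gf_F_rec] by simp
next
  case (Suc m)
  have A: "finite A" "card A = k"
    using Suc.prems by (auto simp: state_F_def)
  have "(of_nat (tree_count (Suc m) n A u) :: rat) = (\<Sum>g\<in>A. (al ^ card {h \<in> A. g \<le> h}) $ m)"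
    unfolding of_nat_tree_count_Suc using Suc.IH children_F[OF Suc.prems] by (intro sum.cong) auto
  also have "\<dots> = (\<Sum>j=1..k. al ^ j) $ m"
    unfolding fps_sum_nth using sum_card_above[OF A(1), of "\<lambda>k. (al ^ k) $ m"] A by simp
  finally show ?case
    using fps_rec_nth(2)[OF gf_F_rec] by metis
qed

lemma count_E': "state_E' k n A u \<Longrightarrow> of_nat (tree_count m n A u) = (al ^ (k + 1)) $ m"
proof (induction m arbitrary: n A u)
  case 0
  show ?case
    using fps_rec_nth(1)[OF gf_E'_rec] by simp
next
  case (Suc m)
  obtain a P where P: "A = insert a P" "a \<notin> P" "finite P" "card P = k"
    "state_E' k (Suc n) (child_gaps n A u a) (child_top u a)"
    "\<And>p. p \<in> P \<Longrightarrow> state_F (card {h \<in> P. p \<le> h}) (child_gaps n A u p) (child_top u p)"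
    using Suc.prems by (rule children_E') blast
  have "(of_nat (tree_count (Suc m) n A u) :: rat) =
    of_nat (tree_count m (Suc n) (child_gaps n A u a) (child_top u a)) +
    (\<Sum>p\<in>P. of_nat (tree_count m (Suc n) (child_gaps n A u p) (child_top u p)))"
    unfolding of_nat_tree_count_Suc using P(1-3) by simp
  also have "\<dots> = (al ^ (k + 1)) $ m + (\<Sum>p\<in>P. (al ^ card {h \<in> P. p \<le> h}) $ m)"
    using Suc.IH[OF P(5)] count_F[OF P(6)] by simp
  also have "\<dots> = (al ^ (k + 1) + (\<Sum>j=1..k. al ^ j)) $ m"
    using sum_card_above[OF P(3), of "\<lambda>k. (al ^ k) $ m"] P(4) by (simp add: fps_sum_nth)
  finally show ?case
    using fps_rec_nth(2)[OF gf_E'_rec] by metis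
qed

lemma count_E: "state_E k n A u \<Longrightarrow> of_nat (tree_count m n A u) = gf_E k $ m"
proof (induction m arbitrary: k n A u)
  case 0
  then obtain l where "k = Suc l"
    unfolding state_E_def by blast
  then show ?case
    using fps_rec_nth(1)[OF gf_E_rec] by simp
next
  case (Suc m)
  obtain a P c where P: "A = insert a (insert c P)" "a \<notin> P" "a \<noteq> c" "c \<notin> P"
    "finite P" "Suc (card P) = k"
    "state_E k (Suc n) (child_gaps n A u a) (child_top u a)"
    "state_E 1 (Suc n) (child_gaps n A u c) (child_top u c)"
    "\<And>p. p \<in> P \<Longrightarrow> state_F (Suc (card {h \<in> P. p \<le> h})) (child_gaps n A u p) (child_top u p)"
    using Suc.prems by (rule children_E) blast
  have "(of_nat (tree_count (Suc m) n A u) :: rat) =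
    of_nat (tree_count m (Suc n) (child_gaps n A u a) (child_top u a)) +
    of_nat (tree_count m (Suc n) (child_gaps n A u c) (child_top u c)) +
    (\<Sum>p\<in>P. of_nat (tree_count m (Suc n) (child_gaps n A u p) (child_top u p)))"
    unfolding of_nat_tree_count_Suc using P(1-5) by (simp add: add.assoc)
  also have "\<dots> = gf_E k $ m + gf_E 1 $ m + (\<Sum>p\<in>P. (al ^ (card {h \<in> P. p \<le> h} + 1)) $ m)"
    using Suc.IH[OF P(7)] Suc.IH[OF P(8)] count_F[OF P(9)] by simp
  also have "\<dots> = (gf_E k + gf_E 1 + (\<Sum>j=1..card P. al ^ (j + 1))) $ m"
    using sum_card_above[OF P(5), of "\<lambda>k. (al ^ (k + 1)) $ m"] by (simp add: fps_sum_nth)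
  also have "\<dots> = gf_E k $ Suc m"
    using fps_rec_nth(2)[OF gf_E_rec] P(6) by metis
  finally show ?case .
qed

lemma count_G: "state_G i r n A u \<Longrightarrow> of_nat (tree_count m n A u) = (al ^ (i + r + 1)) $ m"
proof (induction m arbitrary: r n A u)
  case 0
  show ?case
    using fps_rec_nth(1)[OF gf_G_rec] by simp
next
  case (Suc m)
  obtain L b R where S: "A = L \<union> insert b R" "finite L" "finite R" "card L = i" "card R = r"
    "b \<notin> L" "b \<notin> R" "L \<inter> R = {}"
    "\<And>l. l \<in> L \<Longrightarrow> state_E' (card {h \<in> L. l \<le> h}) (Suc n) (child_gaps n A u l) (child_top u l)"
    "state_E' 0 (Suc n) (child_gaps n A u b) (child_top u b)"
    "\<And>c. c \<in> R \<Longrightarrow> state_G i (card {h \<in> R. c \<le> h}) (Suc n) (child_gaps n A u c) (child_top u c)"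
    using Suc.prems by (rule children_G) blast
  have split: "sum f A = sum f L + f b + sum f R" for f :: "nat \<Rightarrow> rat"
    unfolding S(1) by (subst sum.union_disjoint) (use S(2-8) in \<open>auto simp: add.assoc\<close>)
  have "(of_nat (tree_count (Suc m) n A u) :: rat) =
    (\<Sum>l\<in>L. of_nat (tree_count m (Suc n) (child_gaps n A u l) (child_top u l))) +
    of_nat (tree_count m (Suc n) (child_gaps n A u b) (child_top u b)) +
    (\<Sum>c\<in>R. of_nat (tree_count m (Suc n) (child_gaps n A u c) (child_top u c)))"
    by (simp only: of_nat_tree_count_Suc split)
  also have "\<dots> = (\<Sum>l\<in>L. (al ^ (card {h \<in> L. l \<le> h} + 1)) $ m) + al $ m +
      (\<Sum>c\<in>R. (al ^ (card {h \<in> R. c \<le> h} + (i + 1))) $ m)"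
    using count_E'[OF S(9)] count_E'[OF S(10)] Suc.IH[OF S(11)] by (simp add: ac_simps)
  also have "\<dots> = ((\<Sum>k=1..i. al ^ (k + 1)) + al + (\<Sum>k=1..r. al ^ (k + (i + 1)))) $ m"
    using sum_card_above[OF S(2), of "\<lambda>k. (al ^ (k + 1)) $ m"]
      sum_card_above[OF S(3), of "\<lambda>k. (al ^ (k + (i + 1))) $ m"] S(4,5) by (simp add: fps_sum_nth)
  also have "\<dots> = (al ^ (i + r + 1)) $ Suc m"
    using fps_rec_nth(2)[OF gf_G_rec] by metis
  finally show ?case .
qed

lemma count_C: "state_C i r n A u \<Longrightarrow> of_nat (tree_count m n A u) = gf_C i r $ m"
proof (induction m arbitrary: n A u)
  case 0
  show ?case
    using fps_rec_nth(1)[OF gf_C_rec] by simp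
next
  case (Suc m)
  obtain L b c R where S: "A = L \<union> insert b (insert c R)" "finite L" "finite R" "card L = i" "card R = r"
    "b \<notin> L" "c \<notin> L" "b \<noteq> c" "b \<notin> R" "c \<notin> R" "L \<inter> R = {}"
    "\<And>l. l \<in> L \<Longrightarrow> state_E' (card {h \<in> L. l \<le> h}) (Suc n) (child_gaps n A u l) (child_top u l)"
    "state_E 1 (Suc n) (child_gaps n A u b) (child_top u b)"
    "state_C i r (Suc n) (child_gaps n A u c) (child_top u c)"
    "\<And>d. d \<in> R \<Longrightarrow> state_G i (card {h \<in> R. d \<le> h}) (Suc n) (child_gaps n A u d) (child_top u d)"
    using Suc.prems by (rule children_C) blast
  have split: "sum f A = sum f L + f b + f c + sum f R" for f :: "nat \<Rightarrow> rat"
    unfolding S(1) by (subst sum.union_disjoint) (use S(2-11) in \<open>auto simp: add.assoc\<close>)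
  have "(of_nat (tree_count (Suc m) n A u) :: rat) =
    (\<Sum>l\<in>L. of_nat (tree_count m (Suc n) (child_gaps n A u l) (child_top u l))) +
    of_nat (tree_count m (Suc n) (child_gaps n A u b) (child_top u b)) +
    of_nat (tree_count m (Suc n) (child_gaps n A u c) (child_top u c)) +
    (\<Sum>d\<in>R. of_nat (tree_count m (Suc n) (child_gaps n A u d) (child_top u d)))"
    by (simp only: of_nat_tree_count_Suc split)
  also have "\<dots> = (\<Sum>l\<in>L. (al ^ (card {h \<in> L. l \<le> h} + 1)) $ m) + gf_E 1 $ m + gf_C i r $ m +
      (\<Sum>d\<in>R. (al ^ (card {h \<in> R. d \<le> h} + (i + 1))) $ m)"
    using count_E'[OF S(12)] count_E[OF S(13)] Suc.IH[OF S(14)] count_G[OF S(15)]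
    by (simp add: ac_simps)
  also have "\<dots> = ((\<Sum>k=1..i. al ^ (k + 1)) + gf_E 1 + gf_C i r + (\<Sum>k=1..r. al ^ (k + (i + 1)))) $ m"
    using sum_card_above[OF S(2), of "\<lambda>k. (al ^ (k + 1)) $ m"]
      sum_card_above[OF S(3), of "\<lambda>k. (al ^ (k + (i + 1))) $ m"] S(4,5) by (simp add: fps_sum_nth)
  also have "\<dots> = gf_C i r $ Suc m"
    using fps_rec_nth(2)[OF gf_C_rec] by metis
  finally show ?case .
qed

lemma count_B: "state_B i j n A u \<Longrightarrow> of_nat (tree_count m n A u) = gf_B i j $ m"
proof (induction m arbitrary: i j n A u)
  case 0
  then obtain l where "j = Suc l"
    unfolding state_B_def by blast
  then show ?case
    using fps_rec_nth(1)[OF gf_B_rec] by simp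
next
  case (Suc m)
  obtain L b R where S: "A = L \<union> insert b (insert n R)" "finite L" "finite R"
    "card L = i" "Suc (card R) = j"
    "b \<notin> L" "n \<notin> L" "b \<noteq> n" "b \<notin> R" "n \<notin> R" "L \<inter> R = {}"
    "\<And>l. l \<in> L \<Longrightarrow> state_E (card {h \<in> L. l \<le> h}) (Suc n) (child_gaps n A u l) (child_top u l)"
    "state_B (Suc i) j (Suc n) (child_gaps n A u b) (child_top u b)"
    "state_B i 1 (Suc n) (child_gaps n A u n) (child_top u n)"
    "\<And>d. d \<in> R \<Longrightarrow> state_C i (card {h \<in> R. d \<le> h}) (Suc n) (child_gaps n A u d) (child_top u d)"
    using Suc.prems by (rule children_B) blast
  have split: "sum f A = sum f L + f b + f n + sum f R" for f :: "nat \<Rightarrow> rat"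
    unfolding S(1) by (subst sum.union_disjoint) (use S(2-11) in \<open>auto simp: add.assoc\<close>)
  have "(of_nat (tree_count (Suc m) n A u) :: rat) =
    (\<Sum>l\<in>L. of_nat (tree_count m (Suc n) (child_gaps n A u l) (child_top u l))) +
    of_nat (tree_count m (Suc n) (child_gaps n A u b) (child_top u b)) +
    of_nat (tree_count m (Suc n) (child_gaps n A u n) (child_top u n)) +
    (\<Sum>d\<in>R. of_nat (tree_count m (Suc n) (child_gaps n A u d) (child_top u d)))"
    by (simp only: of_nat_tree_count_Suc split)
  also have "\<dots> = (\<Sum>l\<in>L. gf_E (card {h \<in> L. l \<le> h}) $ m) + gf_B (Suc i) j $ m + gf_B i 1 $ m +
      (\<Sum>d\<in>R. gf_C i (card {h \<in> R. d \<le> h}) $ m)"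
    using count_E[OF S(12)] Suc.IH[OF S(13)] Suc.IH[OF S(14)] count_C[OF S(15)] by simp
  also have "\<dots> = ((\<Sum>k=1..i. gf_E k) + gf_B (Suc i) j + gf_B i 1 + (\<Sum>r=1..card R. gf_C i r)) $ m"
    using sum_card_above[OF S(2), of "\<lambda>k. gf_E k $ m"]
      sum_card_above[OF S(3), of "\<lambda>k. gf_C i k $ m"] S(4) by (simp add: fps_sum_nth)
  also have "\<dots> = gf_B i j $ Suc m"
    using fps_rec_nth(2)[OF gf_B_rec] S(5) by metis
  finally show ?case .
qed

lemma count_D: "state_D n A u \<Longrightarrow> of_nat (tree_count m n A u) = gf_D n $ m"
proof (induction m arbitrary: n A u)
  case 0
  show ?case
    using fps_rec_nth(1)[OF gf_D_rec] by simp
next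
  case (Suc m)
  note D = children_D[OF Suc.prems]
  have "{0..n} = insert n {..<n}"
    by auto
  then have split: "sum f A = sum f {..<n} + f n" for f :: "nat \<Rightarrow> rat"
    unfolding D(1) by (simp add: add.commute)
  have "(of_nat (tree_count (Suc m) n A u) :: rat) =
    (\<Sum>g<n. of_nat (tree_count m (Suc n) (child_gaps n A u g) (child_top u g))) +
    of_nat (tree_count m (Suc n) (child_gaps n A u n) (child_top u n))"
    by (simp only: of_nat_tree_count_Suc split)
  also have "\<dots> = (\<Sum>g<n. gf_B (Suc g) (n - g) $ m) + gf_D (Suc n) $ m"
    using Suc.IH[OF D(2)] count_B[OF D(3)] by simp
  also have "\<dots> = ((\<Sum>g<n. gf_B (Suc g) (n - g)) + gf_D (Suc n)) $ m"
    by (simp add: fps_sum_nth)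
  also have "\<dots> = gf_D n $ Suc m"
    using fps_rec_nth(2)[OF gf_D_rec] by metis
  finally show ?case .
qed

section \<open>From permutations to the tree\<close>

lemma subseq_map_iff: "subseq xs (map f ys) \<longleftrightarrow> (\<exists>zs. subseq zs ys \<and> xs = map f zs)"
proof
  assume "subseq xs (map f ys)"
  then show "\<exists>zs. subseq zs ys \<and> xs = map f zs"
  proof (induction ys arbitrary: xs)
    case Nil
    then show ?case by (cases xs) auto
  next
    case (Cons y ys)
    show ?case
    proof (cases "\<exists>xs'. xs = f y # xs' \<and> subseq xs' (map f ys)")
      case True
      then obtain xs' zs where "xs = f y # xs'" "subseq zs ys" "xs' = map f zs"
        using Cons.IH by blast
      then show ?thesis
        by (intro exI[of _ "y # zs"]) auto
    next
      case False
      then have "subseq xs (map f ys)"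
        using Cons.prems by (cases xs) (auto split: if_splits)
      then show ?thesis
        using Cons.IH by blast
    qed
  qed
qed (auto intro: subseq_map)

text \<open>The adjoint of \<open>lift\<close> for comparisons, sending a gap of the new permutation
  to the old gap it comes from. Both \<open>g\<close> and \<open>Suc g\<close> go to
  \<open>g\<close>, the gap split by the new letter.\<close>

definition unlift :: "nat \<Rightarrow> nat \<Rightarrow> nat" where
  "unlift g y = (if y \<le> g then y else y - 1)"

lemma lift_le_iff: "lift g y \<le> h \<longleftrightarrow> y \<le> unlift g h"
  and less_lift_iff: "h < lift g y \<longleftrightarrow> unlift g h < y"
  by (auto simp: lift_def unlift_def)

lemma unlift_low: "h \<le> g \<Longrightarrow> unlift g h = h"
  by (simp add: unlift_def)

lemma lift_unlift: "y \<noteq> Suc g \<Longrightarrow> lift g (unlift g y) = y"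
  and unlift_lift: "unlift g (lift g y) = y"
  by (auto simp: lift_def unlift_def)

lemma inj_lift: "inj_on (lift g) S"
  by (rule inj_on_inverseI[of _ "unlift g"]) (simp add: unlift_lift)

lemma lift_image: "g \<le> n \<Longrightarrow> lift g ` {1..n} = {1..Suc n} - {Suc g}"
proof (intro equalityI subsetI)
  fix y assume "g \<le> n" "y \<in> {1..Suc n} - {Suc g}"
  then have "y = lift g (unlift g y)" "unlift g y \<in> {1..n}"
    by (auto simp: lift_def unlift_def)
  then show "y \<in> lift g ` {1..n}"
    by blast
qed (auto simp: lift_def split: if_splits)

definition prepend :: "nat \<Rightarrow> nat list \<Rightarrow> nat list" where
  "prepend g \<sigma> = Suc g # map (lift g) \<sigma>"

text \<open>With containment stated for an arbitrary predicate, prepending a letter becomes a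
  transformation of the predicate.\<close>

definition has_sub :: "(nat list \<Rightarrow> bool) \<Rightarrow> nat list \<Rightarrow> bool" where
  "has_sub Q \<sigma> \<longleftrightarrow> (\<exists>xs. subseq xs \<sigma> \<and> Q xs)"

fun forbidden :: "nat list \<Rightarrow> bool" where
  "forbidden [a, b, c, d] \<longleftrightarrow>
     a < b \<and> b < c \<and> c < d \<or> c < d \<and> d < a \<and> a < b \<or> b < c \<and> c < d \<and> d < a"
| "forbidden _ \<longleftrightarrow> False"

text \<open>This is \<open>forbidden\<close> with first letter \<open>Suc g\<close>, expressed in
  the values before relabelling: smaller means at most \<open>g\<close>, larger means above
  \<open>g\<close>.\<close>

fun blocks :: "nat \<Rightarrow> nat list \<Rightarrow> bool" where
  "blocks g [b, c, d] \<longleftrightarrow>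
     g < b \<and> b < c \<and> c < d \<or> c < d \<and> d \<le> g \<and> g < b \<or> b < c \<and> c < d \<and> d \<le> g"
| "blocks g _ \<longleftrightarrow> False"

fun ascent :: "nat \<Rightarrow> nat \<Rightarrow> nat list \<Rightarrow> bool" where
  "ascent h y [c, d] \<longleftrightarrow> h < c \<and> c < d \<and> d \<le> y"
| "ascent h y _ \<longleftrightarrow> False"

fun single :: "nat \<Rightarrow> nat \<Rightarrow> nat list \<Rightarrow> bool" where
  "single h y [d] \<longleftrightarrow> h < d \<and> d \<le> y"
| "single h y _ \<longleftrightarrow> False"

definition admissible :: "nat list \<Rightarrow> bool" where
  "admissible \<sigma> \<longleftrightarrow> \<not> has_sub forbidden \<sigma>"

definition active :: "nat list \<Rightarrow> nat \<Rightarrow> bool" where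
  "active \<sigma> g \<longleftrightarrow> \<not> has_sub (blocks g) \<sigma>"

lemma has_sub_disj: "has_sub (\<lambda>xs. P xs \<or> Q xs) \<sigma> \<longleftrightarrow> has_sub P \<sigma> \<or> has_sub Q \<sigma>"
  unfolding has_sub_def by blast

lemma has_sub_cong: "(\<And>xs. set xs \<subseteq> set \<sigma> \<Longrightarrow> P xs = Q xs) \<Longrightarrow> has_sub P \<sigma> \<longleftrightarrow> has_sub Q \<sigma>"
  unfolding has_sub_def using list_emb_set[of "(=)" _ \<sigma>] by (metis subsetI)

lemma has_sub_Nil: "has_sub Q [] \<longleftrightarrow> Q []"
proof -
  have "subseq xs [] \<longleftrightarrow> xs = []" for xs :: "nat list"
    by (cases xs) auto
  then show ?thesis
    by (simp add: has_sub_def)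
qed

lemma has_sub_Cons: "has_sub Q (y # ys) \<longleftrightarrow> has_sub Q ys \<or> has_sub (\<lambda>xs. Q (y # xs)) ys"
proof -
  have "subseq xs (y # ys) \<longleftrightarrow> subseq xs ys \<or> (\<exists>zs. xs = y # zs \<and> subseq zs ys)" for xs
    by (cases xs) (auto dest: subseq_Cons')
  then show ?thesis
    unfolding has_sub_def by blast
qed

lemma has_sub_map: "has_sub Q (map f ys) \<longleftrightarrow> has_sub (\<lambda>xs. Q (map f xs)) ys"
  unfolding has_sub_def subseq_map_iff by blast

lemma has_sub_prepend:
  "has_sub Q (prepend g \<sigma>) \<longleftrightarrow>
     has_sub (\<lambda>xs. Q (map (lift g) xs)) \<sigma> \<or> has_sub (\<lambda>xs. Q (Suc g # map (lift g) xs)) \<sigma>"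
  unfolding prepend_def has_sub_Cons has_sub_map ..

lemma unlift_Suc: "unlift g (Suc g) = g"
  and lift_less_Suc_iff: "lift g y < Suc g \<longleftrightarrow> y \<le> g"
  by (auto simp: lift_def unlift_def)

lemmas lift_iffs = lift_less_Suc_iff lift_le_iff less_lift_iff unlift_lift unlift_Suc

lemma forbidden_map_lift: "forbidden (map (lift g) xs) \<longleftrightarrow> forbidden xs"
  by (cases xs rule: forbidden.cases) (simp_all add: lift_iffs)

lemma forbidden_Cons_lift: "forbidden (Suc g # map (lift g) xs) \<longleftrightarrow> blocks g xs"
  by (cases "(g, xs)" rule: blocks.cases) (auto simp: lift_iffs)

lemma blocks_map_lift: "blocks h (map (lift g) xs) \<longleftrightarrow> blocks (unlift g h) xs"
  by (cases "(g, xs)" rule: blocks.cases) (simp_all add: lift_iffs)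

lemma ascent_map_lift: "ascent h y (map (lift g) xs) \<longleftrightarrow> ascent (unlift g h) (unlift g y) xs"
  by (cases "(g, y, xs)" rule: ascent.cases) (simp_all add: lift_iffs)

lemma ascent_Cons_lift:
  "ascent h y (Suc g # map (lift g) xs) \<longleftrightarrow> h \<le> g \<and> single g (unlift g y) xs"
  by (cases "(g, y, xs)" rule: single.cases) (auto simp: lift_iffs)

text \<open>The second letter \<open>Suc g\<close> exceeds the first, which excludes 4123. An ascent
  above \<open>g\<close> completes 1234, and one with top at most \<open>h\<close> completes 3412;
  the bound \<open>n\<close> in \<open>ascent g n\<close> holds for all letters. These are the two
  conditions on low gaps in \<open>child_gaps\<close>.\<close>

lemma blocks_Cons_lift_low:
  assumes "h \<le> g" "set xs \<subseteq> {1..n}"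
  shows "blocks h (Suc g # map (lift g) xs) \<longleftrightarrow> ascent g n xs \<or> ascent 0 h xs"
  using assms by (cases "(g, n, xs)" rule: ascent.cases) (auto simp: lift_iffs unlift_low)

text \<open>The second letter is now below the first, so only 4123 can arise.\<close>

lemma blocks_Cons_lift_high:
  assumes "g < h"
  shows "blocks h (Suc g # map (lift g) xs) \<longleftrightarrow> ascent g (unlift g h) xs"
  using assms by (cases "(g, h, xs)" rule: ascent.cases) (auto simp: lift_iffs)

lemma admissible_prepend: "admissible (prepend g \<sigma>) \<longleftrightarrow> admissible \<sigma> \<and> active \<sigma> g"
  unfolding admissible_def active_def has_sub_prepend forbidden_map_lift forbidden_Cons_lift
  by blast

text \<open>Specifying \<open>u h\<close> by all comparisons \<open>u h \<le> y\<close> fits the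
  rewriting with \<open>lift_le_iff\<close> and fixes the default \<open>Suc n\<close> as
  well.\<close>

definition tracks :: "nat list \<Rightarrow> nat \<Rightarrow> nat set \<Rightarrow> (nat \<Rightarrow> nat) \<Rightarrow> bool" where
  "tracks \<sigma> n A u \<longleftrightarrow> length \<sigma> = n \<and> set \<sigma> = {1..n} \<and> A = {g. g \<le> n \<and> active \<sigma> g} \<and>
     (\<forall>h y. u h \<le> y \<longleftrightarrow> n < y \<or> has_sub (ascent h y) \<sigma>)"

lemma has_sub_single:
  assumes "set \<sigma> = {1..n}"
  shows "has_sub (single h y) \<sigma> \<longleftrightarrow> h < n \<and> h < y"
proof
  assume "has_sub (single h y) \<sigma>"
  then obtain xs where "subseq xs \<sigma>" "single h y xs"
    by (auto simp: has_sub_def)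
  then show "h < n \<and> h < y"
    using assms by (cases "(h, y, xs)" rule: single.cases) (auto simp: subseq_singleton_left)
next
  assume "h < n \<and> h < y"
  then have "subseq [Suc h] \<sigma>" "single h y [Suc h]"
    using assms by (auto simp: subseq_singleton_left)
  then show "has_sub (single h y) \<sigma>"
    unfolding has_sub_def by blast
qed

lemma tracks_prepend:
  assumes "tracks \<sigma> n A u" "g \<in> A"
  shows "tracks (prepend g \<sigma>) (Suc n) (child_gaps n A u g) (child_top u g)"
proof -
  have S: "length \<sigma> = n" "set \<sigma> = {1..n}" "A = {g. g \<le> n \<and> active \<sigma> g}"
    and u: "u h \<le> y \<longleftrightarrow> n < y \<or> has_sub (ascent h y) \<sigma>" for h y
    using assms(1) by (auto simp: tracks_def)
  have g: "g \<le> n"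
    using assms(2) S(3) by simp
  have less_u: "y < u h \<longleftrightarrow> \<not> has_sub (ascent h y) \<sigma>" if "y \<le> n" for h y
    using u[of h y] that by (meson not_le)
  have active_prepend: "active (prepend g \<sigma>) h \<longleftrightarrow>
      active \<sigma> (unlift g h) \<and> \<not> has_sub (\<lambda>xs. blocks h (Suc g # map (lift g) xs)) \<sigma>" for h
    unfolding active_def has_sub_prepend blocks_map_lift by blast
  have low: "h \<in> child_gaps n A u g \<longleftrightarrow> active (prepend g \<sigma>) h" if h: "h \<le> g" for h
  proof -
    have "has_sub (\<lambda>xs. blocks h (Suc g # map (lift g) xs)) \<sigma> \<longleftrightarrow>
      has_sub (\<lambda>xs. ascent g n xs \<or> ascent 0 h xs) \<sigma>"
      by (rule has_sub_cong) (rule blocks_Cons_lift_low[OF h], simp add: S(2))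
    then have "active (prepend g \<sigma>) h \<longleftrightarrow> active \<sigma> h \<and> n < u g \<and> h < u 0"
      unfolding active_prepend has_sub_disj using h g by (simp add: less_u unlift_def)
    then show ?thesis
      using h g by (auto simp: child_gaps_def S(3))
  qed
  have high: "Suc k \<in> child_gaps n A u g \<longleftrightarrow> active (prepend g \<sigma>) (Suc k)" if "g \<le> k" "k \<le> n" for k
  proof -
    have "active (prepend g \<sigma>) (Suc k) \<longleftrightarrow> active \<sigma> k \<and> k < u g"
      unfolding active_prepend blocks_Cons_lift_high[OF le_imp_less_Suc[OF that(1)]]
      using that by (simp add: less_u unlift_def)
    then show ?thesis
      using that by (auto simp: child_gaps_def S(3))
  qed
  have "h \<in> child_gaps n A u g \<longleftrightarrow> active (prepend g \<sigma>) h" if "h \<le> Suc n" for h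
    using low[of h] high[of "h - 1"] that by (cases "h \<le> g") auto
  moreover have "child_gaps n A u g \<subseteq> {..Suc n}"
    using g by (auto simp: child_gaps_def S(3))
  ultimately have gaps: "child_gaps n A u g = {h. h \<le> Suc n \<and> active (prepend g \<sigma>) h}"
    by auto
  \<comment> \<open>An ascent is either an old one relabelled or starts with the new letter; the
    second case yields the minimum in \<open>child_top\<close>.\<close>
  have pairs: "has_sub (ascent h y) (prepend g \<sigma>) \<longleftrightarrow>
    has_sub (ascent (unlift g h) (unlift g y)) \<sigma> \<or> h \<le> g \<and> g < n \<and> g < unlift g y" for h y
  proof -
    have "has_sub (\<lambda>xs. h \<le> g \<and> single g (unlift g y) xs) \<sigma> \<longleftrightarrow> h \<le> g \<and> has_sub (single g (unlift g y)) \<sigma>"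
      unfolding has_sub_def by blast
    then show ?thesis
      unfolding has_sub_prepend ascent_map_lift ascent_Cons_lift has_sub_single[OF S(2)] by simp
  qed
  have n_unlift: "n < unlift g y \<longleftrightarrow> Suc n < y" for y
    using g by (auto simp: unlift_def)
  have top: "child_top u g h \<le> y \<longleftrightarrow> Suc n < y \<or> has_sub (ascent h y) (prepend g \<sigma>)" for h y
  proof (cases "h \<le> g")
    case True
    have "g < unlift g y \<longleftrightarrow> g + 2 \<le> y"
      by (auto simp: unlift_def)
    moreover have "child_top u g h \<le> y \<longleftrightarrow> u h \<le> unlift g y \<or> g + 2 \<le> y"
      using True by (simp add: child_top_def min_le_iff_disj lift_le_iff)
    moreover have "unlift g h = h"
      using True by (simp add: unlift_def)
    ultimately show ?thesis
      unfolding pairs u n_unlift using True g by auto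
  next
    case False
    then have "child_top u g h \<le> y \<longleftrightarrow> u (unlift g h) \<le> unlift g y"
      by (simp add: child_top_def lift_le_iff unlift_def)
    then show ?thesis
      unfolding pairs u n_unlift using False by auto
  qed
  have "set (prepend g \<sigma>) = {1..Suc n}"
    unfolding prepend_def list.set set_map S(2) lift_image[OF g] using g by auto
  then show ?thesis
    unfolding tracks_def using gaps top S(1) by (simp add: prepend_def)
qed

lemma tracks_Nil: "tracks [] 0 {0} (\<lambda>_. 1)"
  by (auto simp: tracks_def active_def has_sub_Nil)

section \<open>Counting avoiders by descendants\<close>

primrec descendants :: "nat \<Rightarrow> nat list \<Rightarrow> nat" where
  "descendants 0 \<sigma> = 1"
| "descendants (Suc m) \<sigma> = (\<Sum>g | g \<le> length \<sigma> \<and> active \<sigma> g. descendants m (prepend g \<sigma>))"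

lemma descendants_eq_tree_count: "tracks \<sigma> n A u \<Longrightarrow> descendants m \<sigma> = tree_count m n A u"
proof (induction m arbitrary: \<sigma> n A u)
  case (Suc m)
  then have "A = {g. g \<le> length \<sigma> \<and> active \<sigma> g}"
    by (auto simp: tracks_def)
  then show ?case
    using Suc.IH[OF tracks_prepend[OF Suc.prems]] by simp
qed simp

definition Av :: "nat \<Rightarrow> nat list set" where
  "Av n = {\<sigma> \<in> permutations_of_set {1..n}. admissible \<sigma>}"

text \<open>Deleting the first letter and closing its gap preserves avoidance, so every avoider has
  a parent; \<open>inj_prepend\<close> makes it unique.\<close>

lemma Av_Suc:
  "Av (Suc n) = (\<lambda>(\<sigma>, g). prepend g \<sigma>) ` (SIGMA \<sigma>:Av n. {g. g \<le> length \<sigma> \<and> active \<sigma> g})"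
proof (intro equalityI subsetI)
  fix \<pi> assume \<pi>: "\<pi> \<in> Av (Suc n)"
  then have "\<pi> \<noteq> []"
    by (auto simp: Av_def permutations_of_set_def)
  then obtain v \<tau> where v: "\<pi> = v # \<tau>"
    by (cases \<pi>) auto
  define g \<sigma> where "g = v - 1" and "\<sigma> = map (unlift g) \<tau>"
  have \<tau>: "distinct \<tau>" "set \<tau> = {1..Suc n} - {v}" "v \<in> {1..Suc n}" "admissible \<pi>"
    using \<pi> by (auto simp: Av_def permutations_of_set_def v)
  have g: "v = Suc g" "g \<le> n"
    using \<tau>(3) by (auto simp: g_def)
  have "map (lift g) \<sigma> = \<tau>"
    unfolding \<sigma>_def map_map using \<tau>(2) g by (intro map_idI) (auto simp: lift_unlift)
  then have pre: "\<pi> = prepend g \<sigma>"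
    by (simp add: prepend_def v g)
  have "set \<sigma> = unlift g ` lift g ` {1..n}"
    unfolding \<sigma>_def set_map \<tau>(2) lift_image[OF g(2)] g(1) ..
  then have "set \<sigma> = {1..n}"
    by (simp add: image_image unlift_lift)
  moreover have "distinct \<sigma>"
    using \<tau>(1) \<open>map (lift g) \<sigma> = \<tau>\<close> by (metis distinct_map)
  ultimately have "\<sigma> \<in> Av n" "g \<le> length \<sigma>" "active \<sigma> g"
    using \<tau>(4) g(2) distinct_card[of \<sigma>] unfolding pre admissible_prepend
    by (auto simp: Av_def permutations_of_set_def)
  then show "\<pi> \<in> (\<lambda>(\<sigma>, g). prepend g \<sigma>) ` (SIGMA \<sigma>:Av n. {g. g \<le> length \<sigma> \<and> active \<sigma> g})"
    using pre by auto
next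
  fix \<pi> assume "\<pi> \<in> (\<lambda>(\<sigma>, g). prepend g \<sigma>) ` (SIGMA \<sigma>:Av n. {g. g \<le> length \<sigma> \<and> active \<sigma> g})"
  then obtain \<sigma> g where \<sigma>: "\<pi> = prepend g \<sigma>" "\<sigma> \<in> Av n" "g \<le> length \<sigma>" "active \<sigma> g"
    by auto
  then have S: "set \<sigma> = {1..n}" "distinct \<sigma>" "admissible \<sigma>"
    by (auto simp: Av_def permutations_of_set_def)
  then have "g \<le> n"
    using \<sigma>(3) distinct_card[of \<sigma>] by simp
  then have "set \<pi> = {1..Suc n}"
    unfolding \<sigma>(1) prepend_def list.set set_map S(1) lift_image[OF \<open>g \<le> n\<close>] by auto
  moreover have "distinct \<pi>"
    using S(1,2) lift_image[OF \<open>g \<le> n\<close>] by (auto simp: \<sigma>(1) prepend_def distinct_map inj_lift)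
  ultimately show "\<pi> \<in> Av (Suc n)"
    using S \<sigma> by (auto simp: Av_def permutations_of_set_def admissible_prepend)
qed

lemma inj_prepend: "inj_on (\<lambda>(\<sigma>, g). prepend g \<sigma>) S"
  by (rule inj_onI) (auto simp: prepend_def inj_map_eq_map[OF inj_lift])

lemma finite_Av: "finite (Av n)"
  by (simp add: Av_def)

lemma sum_descendants: "(\<Sum>\<sigma>\<in>Av n. descendants m \<sigma>) = card (Av (n + m))"
proof (induction m arbitrary: n)
  case (Suc m)
  have "(\<Sum>\<sigma>\<in>Av n. descendants (Suc m) \<sigma>) =
    (\<Sum>(\<sigma>, g)\<in>(SIGMA \<sigma>:Av n. {g. g \<le> length \<sigma> \<and> active \<sigma> g}). descendants m (prepend g \<sigma>))"
    by (simp add: sum.Sigma finite_Av)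
  also have "\<dots> = (\<Sum>\<pi>\<in>Av (Suc n). descendants m \<pi>)"
    unfolding Av_Suc by (subst sum.reindex[OF inj_prepend]) (auto intro: sum.cong)
  finally show ?case
    using Suc.IH[of "Suc n"] by simp
qed simp

lemma card_Av: "card (Av n) = tree_count n 0 {0} (\<lambda>_. 1)"
proof -
  have "Av 0 = {[]}"
    by (auto simp: Av_def admissible_def has_sub_Nil)
  then show ?thesis
    using sum_descendants[of n 0] descendants_eq_tree_count[OF tracks_Nil, of n] by simp
qed

lemma order_isomorphic_forbidden:
  "(\<exists>\<tau>\<in>{[1,2,3,4], [3,4,1,2], [4,1,2,3]}. order_isomorphic xs \<tau>) \<longleftrightarrow> forbidden xs"
proof (cases "length xs = 4")
  case True
  then obtain a b c d where "xs = [a, b, c, d]"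
    by (auto simp: length_Suc_conv numeral_eq_Suc)
  moreover have "order_isomorphic [a, b, c, d] [1,2,3,4] \<longleftrightarrow> a < b \<and> b < c \<and> c < d"
    "order_isomorphic [a, b, c, d] [3,4,1,2] \<longleftrightarrow> c < d \<and> d < a \<and> a < b"
    "order_isomorphic [a, b, c, d] [4,1,2,3] \<longleftrightarrow> b < c \<and> c < d \<and> d < a"
    by (simp_all add: order_isomorphic_def All_less_Suc) linarith+
  ultimately show ?thesis
    by simp
next
  case False
  then show ?thesis
    by (cases xs rule: forbidden.cases) (auto simp: order_isomorphic_def)
qed

lemma avoiders_eq_Av: "avoiders n {[1,2,3,4], [3,4,1,2], [4,1,2,3]} = Av n"
proof -
  have "(\<forall>\<tau>\<in>{[1,2,3,4], [3,4,1,2], [4,1,2,3]}. avoids \<sigma> \<tau>) \<longleftrightarrow> admissible \<sigma>" for \<sigma>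
    unfolding avoids_def admissible_def has_sub_def order_isomorphic_forbidden[symmetric] by blast
  then show ?thesis
    unfolding avoiders_def Av_def by blast
qed

lemma avoiders_gf_eq: "avoiders_gf {[1,2,3,4], [3,4,1,2], [4,1,2,3]} = gf_D 0"
proof (rule fps_ext)
  fix n
  have "state_D 0 {0} (\<lambda>_. 1)"
    by (simp add: state_D_def)
  then have "of_nat (card (Av n)) = gf_D 0 $ n"
    unfolding card_Av by (rule count_D)
  then show "avoiders_gf {[1,2,3,4], [3,4,1,2], [4,1,2,3]} $ n = gf_D 0 $ n"
    unfolding avoiders_gf_def avoiders_eq_Av by simp
qed

theorem theorem3p22:
  fixes T :: "nat list set" and x :: "rat fps"
  defines "T \<equiv> {[1,2,3,4], [3,4,1,2], [4,1,2,3]}"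
    and "x \<equiv> fps_X"
  shows "avoiders_gf T =
    (1 - 14 * x + 87 * x^2 - 315 * x^3 + 736 * x^4 - 1161 * x^5 + 1253 * x^6
       - 918 * x^7 + 446 * x^8 - 134 * x^9 + 18 * x^10)
    / ((1 - x)^6 * (1 - 2 * x)^3 * (1 - 3 * x + x^2))"
proof -
  \<comment> \<open>Each factor has an inverse, namely \<open>al\<close>, \<open>be\<close> or
    \<open>ga\<close>, so none is zero.\<close>
  have "(1 - x)^6 * (1 - 2 * x)^3 * (1 - 3 * x + x^2) \<noteq> 0"
    using al_eq be_eq ga_eq unfolding x_def by auto
  then show ?thesis
    unfolding T_def avoiders_gf_eq gf_D_0[folded x_def, symmetric]
    by (rule nonzero_mult_div_cancel_right[symmetric])
qed

end
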